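(* Let $\rho\in(0,\lambda_0)$, let $X$, $Q$, $\Lambda$, $\tilde\psi_\alpha$ be as in the context, and put $$H_\rho=\Lambda_1^*\Lambda_1+\dots+\Lambda_n^*\Lambda_n+\rho^2 .$$ Then for all multi-indices $\alpha,\beta\in\mathbb N_0^n$, $$H_\rho\tilde\psi_\alpha=(2|\alpha|+1)\rho^2\,\tilde\psi_\alpha,$$ $$(\tilde\psi_\alpha,\tilde\psi_\beta)_{\mathscr H_\Phi(\mathbb C^n)}=\delta_{\alpha\beta}\,(2\rho^2)^{|\alpha|}\,\alpha!\,\|\tilde\psi_0\|^2_{\mathscr H_\Phi(\mathbb C^n)} .$$
   Context: Let $n\ge 1$. For column vectors $z,\zeta\in\mathbb C^n$ write $\langle z,\zeta\rangle=\sum_{j}z_j\zeta_j$ (bilinear, no conjugation). For a matrix $M$, ${}^tM$ is the transpose, $\overline M$ the entrywise conjugate, $M^*={}^t\overline M$. Fix complex $n\times n$ matrices $A,B,C$ with ${}^tA=A$, $\det B\ne0$, ${}^tC=C$ and $C_I=\frac{C-\overline C}{2\sqrt{-1}}$ positive definite. Set $$\Phi''_{z\bar z}=\tfrac14 BC_I^{-1}B^*,\qquad \Phi''_{zz}=-\tfrac14BC_I^{-1}\,{}^tB-\tfrac{A}{2\sqrt{-1}},\qquad \Phi(z)=\langle z,\Phi''_{z\bar z}\bar z\rangle+\operatorname{Re}\langle z,\Phi''_{zz}z\rangle .$$ $\Phi''_{z\bar z}$ is positive definite Hermitian, $\Phi''_{zz}$ is complex symmetric. $\mathscr H_\Phi(\mathbb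 C^n)$ is the Hilbert space of entire functions $F$ on $\mathbb C^n$ with $\int|F|^2e^{-2\Phi}L(dz)<\infty$ ($L$ Lebesgue measure), with inner product $(F,G)=(F,G)_{\mathscr H_\Phi(\mathbb C^n)}=\int_{\mathbb C^n}F\overline Ge^{-2\Phi}L(dz)$ and corresponding norm. The eigenvalues of $\Phi''_{z\bar z}$ (with multiplicity) are $\lambda_1^2,\dots,\lambda_n^2$ with $\lambda_i>0$; $\lambda_0=\min_i\lambda_i$; $U$ is a fixed unitary matrix with $U^*\Phi''_{z\bar z}U=\operatorname{diag}(\lambda_1^2,\dots,\lambda_n^2)$. Fix $\rho\in(0,\lambda_0)$ and put $\mu_i=\sqrt{\lambda_i^2-\rho^2}>0$. Fix an $n\times n$ unitary matrix $X$ with ${}^tX\operatorname{diag}(\mu_1/\lambda_1,\dots,\mu_n/\lambda_n)=\operatorname{diag}(\mu_1/\lambda_1,\dots,\mu_n/\lambda_n)X$, and define the (complex symmetric) matrix $$Q=[q_{ij}]=-\Phi''_{zz}+U\operatorname{diag}(\mu_1,\dots,\mu_n)X\operatorname{diag}(\lambda_1,\dots,\lambda_n)\,{}^tU .$$ Put $\tilde\psi_0(z)=\exp(-\langle z,Qz\rangle)$ and $\Lambda_i=\frac{\partial}{\partial z_i}+2\sum_j q_{ij}z_j$, acting on entire functions. $\Lambda_i^*$ denotes the adjoint of $\Lambda_i$ in $\mathscr H_\Phi(\mathbb C^n)$, understood as the differential operator: the unique operator of the form $\sum_k a_k\frac{\partial}{\partial z_k}+\sum_k b_kz_k+c$ with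 complex constants $a_k,b_k,c$ such that $(\Lambda_iF,G)=(F,\Lambda_i^*G)$ for all $F,G\in\mathscr H_\Phi(\mathbb C^n)$ with $z_kF,\ \partial F/\partial z_k,\ z_kG,\ \partial G/\partial z_k\in\mathscr H_\Phi(\mathbb C^n)$ for all $k$. (The $\Lambda_i^*$ commute with each other.) For $\alpha=(\alpha_1,\dots,\alpha_n)\in\mathbb N_0^n$ ($\mathbb N_0$ the nonnegative integers), $|\alpha|=\sum\alpha_i$, $\alpha!=\prod\alpha_i!$, and $\tilde\psi_\alpha=(\Lambda_1^* )^{\alpha_1}\cdots(\Lambda_n^* )^{\alpha_n}\tilde\psi_0\in\mathscr H_\Phi(\mathbb C^n)$; $\delta_{\alpha\beta}=1$ if $\alpha=\beta$ and $0$ otherwise. *)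

theory Defs
  imports "HOL-Analysis.Analysis"
begin

section \<open>Complex vectors and matrices\<close>

definition bilin :: "complex^'n \<Rightarrow> complex^'n \<Rightarrow> complex" where
  "bilin z w = (\<Sum>j\<in>UNIV. z $ j * w $ j)"

definition cnj_vec :: "complex^'n \<Rightarrow> complex^'n" where
  "cnj_vec z = (\<chi> j. cnj (z $ j))"

definition cnj_mat :: "complex^'n^'m \<Rightarrow> complex^'n^'m" where
  "cnj_mat M = map_matrix cnj M"

definition adjoint_mat :: "complex^'n^'m \<Rightarrow> complex^'m^'n" where
  "adjoint_mat M = transpose (cnj_mat M)"

definition scale_mat :: "complex \<Rightarrow> complex^'n^'m \<Rightarrow> complex^'n^'m" where
  "scale_mat c M = map_matrix ((*) c) M"

definition unitary_mat :: "complex^'n^'n \<Rightarrow> bool" where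
  "unitary_mat U \<longleftrightarrow> adjoint_mat U ** U = mat 1 \<and> U ** adjoint_mat U = mat 1"

definition pos_def_mat :: "complex^'n^'n \<Rightarrow> bool" where
  "pos_def_mat M \<longleftrightarrow> adjoint_mat M = M \<and> (\<forall>z. z \<noteq> 0 \<longrightarrow> 0 < Re (bilin (cnj_vec z) (M *v z)))"

definition diag_mat :: "('n \<Rightarrow> real) \<Rightarrow> complex^'n^'n" where
  "diag_mat d = (\<chi> i j. if i = j then complex_of_real (d i) else 0)"

section \<open>The weight\<close>

definition imag_mat :: "complex^'n^'n \<Rightarrow> complex^'n^'n" where
  "imag_mat C = scale_mat (1 / (2 * \<i>)) (C - cnj_mat C)"

definition Phi_zzbar :: "complex^'n^'n \<Rightarrow> complex^'n^'n \<Rightarrow> complex^'n^'n" where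
  "Phi_zzbar B C = scale_mat (1/4) (B ** matrix_inv (imag_mat C) ** adjoint_mat B)"

definition Phi_zz :: "complex^'n^'n \<Rightarrow> complex^'n^'n \<Rightarrow> complex^'n^'n \<Rightarrow> complex^'n^'n" where
  "Phi_zz A B C = - scale_mat (1/4) (B ** matrix_inv (imag_mat C) ** transpose B)
                  - scale_mat (1 / (2 * \<i>)) A"

text \<open>The first summand inside \<open>Re\<close> below is already real when \<open>Phi_zzbar B C\<close> is Hermitian.\<close>

definition Phi :: "complex^'n^'n \<Rightarrow> complex^'n^'n \<Rightarrow> complex^'n^'n \<Rightarrow> complex^'n \<Rightarrow> real" where
  "Phi A B C z = Re (bilin z (Phi_zzbar B C *v cnj_vec z)) + Re (bilin z (Phi_zz A B C *v z))"

section \<open>The weighted space of entire functions\<close>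

text \<open>Holomorphy in several variables: the real Frechet derivative exists and is complex linear.\<close>

definition entire :: "(complex^'n \<Rightarrow> complex) \<Rightarrow> bool" where
  "entire F \<longleftrightarrow> (\<forall>z. \<exists>D. (F has_derivative D) (at z) \<and> (\<forall>c v. D (c *s v) = c * D v))"

definition pd :: "'n \<Rightarrow> (complex^'n \<Rightarrow> complex) \<Rightarrow> complex^'n \<Rightarrow> complex" where
  "pd k F z = deriv (\<lambda>t. F (z + axis k t)) 0"

definition H_space :: "(complex^'n \<Rightarrow> real) \<Rightarrow> (complex^'n \<Rightarrow> complex) set" where
  "H_space \<Phi> = {F. entire F \<and> integrable lborel (\<lambda>z. (cmod (F z))\<^sup>2 * exp (- 2 * \<Phi> z))}"

definition H_inner ::
  "(complex^'n \<Rightarrow> real) \<Rightarrow> (complex^'n \<Rightarrow> complex) \<Rightarrow> (complex^'n \<Rightarrow> complex) \<Rightarrow> complex" where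
  "H_inner \<Phi> F G = (LINT z|lborel. F z * cnj (G z) * complex_of_real (exp (- 2 * \<Phi> z)))"

definition H_norm :: "(complex^'n \<Rightarrow> real) \<Rightarrow> (complex^'n \<Rightarrow> complex) \<Rightarrow> real" where
  "H_norm \<Phi> F = sqrt (Re (H_inner \<Phi> F F))"

section \<open>First-order operators and their adjoints\<close>

type_synonym 'n operator = "(complex^'n \<Rightarrow> complex) \<Rightarrow> complex^'n \<Rightarrow> complex"

definition first_order_op :: "complex^'n \<Rightarrow> complex^'n \<Rightarrow> complex \<Rightarrow> 'n operator" where
  "first_order_op a b c F z =
     (\<Sum>k\<in>UNIV. a $ k * pd k F z) + (\<Sum>k\<in>UNIV. b $ k * z $ k) * F z + c * F z"

definition adjoint_domain :: "(complex^'n \<Rightarrow> real) \<Rightarrow> (complex^'n \<Rightarrow> complex) set" where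
  "adjoint_domain \<Phi> = {F \<in> H_space \<Phi>. \<forall>k. (\<lambda>z. z $ k * F z) \<in> H_space \<Phi> \<and> pd k F \<in> H_space \<Phi>}"

definition is_adjoint_op :: "(complex^'n \<Rightarrow> real) \<Rightarrow> 'n operator \<Rightarrow> 'n operator \<Rightarrow> bool" where
  "is_adjoint_op \<Phi> T S \<longleftrightarrow>
     (\<exists>a b c. S = first_order_op a b c) \<and>
     (\<forall>F\<in>adjoint_domain \<Phi>. \<forall>G\<in>adjoint_domain \<Phi>. H_inner \<Phi> (T F) G = H_inner \<Phi> F (S G))"

text \<open>Operators are HOL functions on all functions, not only on entire ones. This does not affect
  uniqueness: \<open>first_order_op a b c\<close> is determined by its coefficients, and these are determined by
  its action on entire functions.\<close>

definition adjoint_op :: "(complex^'n \<Rightarrow> real) \<Rightarrow> 'n operator \<Rightarrow> 'n operator" where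
  "adjoint_op \<Phi> T = (THE S. is_adjoint_op \<Phi> T S)"

section \<open>The operators \<open>\<Lambda>\<^sub>i\<close>, \<open>H\<^sub>\<rho>\<close> and the functions \<open>\<psi>\<^sub>\<alpha>\<close>\<close>

definition mu :: "('n \<Rightarrow> real) \<Rightarrow> real \<Rightarrow> 'n \<Rightarrow> real" where
  "mu lam \<rho> i = sqrt ((lam i)\<^sup>2 - \<rho>\<^sup>2)"

definition Q_mat ::
  "complex^'n^'n \<Rightarrow> complex^'n^'n \<Rightarrow> complex^'n^'n \<Rightarrow> complex^'n^'n \<Rightarrow> ('n \<Rightarrow> real) \<Rightarrow> real
     \<Rightarrow> complex^'n^'n \<Rightarrow> complex^'n^'n" where
  "Q_mat A B C U lam \<rho> X =
     - Phi_zz A B C + U ** diag_mat (mu lam \<rho>) ** X ** diag_mat lam ** transpose U"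

definition Lambda :: "complex^'n^'n \<Rightarrow> 'n \<Rightarrow> 'n operator" where
  "Lambda Q i F z = pd i F z + 2 * (\<Sum>j\<in>UNIV. Q $ i $ j * z $ j) * F z"

definition Lambda_star :: "(complex^'n \<Rightarrow> real) \<Rightarrow> complex^'n^'n \<Rightarrow> 'n \<Rightarrow> 'n operator" where
  "Lambda_star \<Phi> Q i = adjoint_op \<Phi> (Lambda Q i)"

definition H_op :: "(complex^'n \<Rightarrow> real) \<Rightarrow> complex^'n^'n \<Rightarrow> real \<Rightarrow> 'n operator" where
  "H_op \<Phi> Q \<rho> F z =
     (\<Sum>i\<in>UNIV. Lambda_star \<Phi> Q i (Lambda Q i F) z) + complex_of_real (\<rho>\<^sup>2) * F z"

definition psi0 :: "complex^'n^'n \<Rightarrow> complex^'n \<Rightarrow> complex" where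
  "psi0 Q z = exp (- bilin z (Q *v z))"

text \<open>The ordered index type plays the role of \<open>{1,\<dots>,n}\<close>, so that the product of the operators is
  taken in the order \<open>1,\<dots>,n\<close> from left to right (the operator with the largest index acts first).\<close>

definition psi ::
  "(complex^'n::{finite,linorder} \<Rightarrow> real) \<Rightarrow> complex^'n::{finite,linorder}^'n::{finite,linorder}
     \<Rightarrow> nat^'n::{finite,linorder} \<Rightarrow> complex^'n::{finite,linorder} \<Rightarrow> complex" where
  "psi \<Phi> Q \<alpha> = foldr (\<lambda>i. Lambda_star \<Phi> Q i ^^ (\<alpha> $ i)) (sorted_list_of_set UNIV) (psi0 Q)"

definition multi_abs :: "nat^'n \<Rightarrow> nat" where
  "multi_abs \<alpha> = (\<Sum>i\<in>UNIV. \<alpha> $ i)"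

definition multi_fact :: "nat^'n \<Rightarrow> nat" where
  "multi_fact \<alpha> = (\<Prod>i\<in>UNIV. fact (\<alpha> $ i))"

end

theory Submission
  imports Defs "HOL-Probability.Distributions"
begin

text \<open>
  Write \<open>P\<close> and \<open>S\<close> for the matrices \<open>Phi_zzbar\<close> and \<open>Phi_zz\<close>, and put \<open>R = Q + S\<close> and \<open>D = \<partial> - 2 S z\<close>.
  Integration by parts shows that \<open>D\<^sub>i\<close> is adjoint to multiplication by \<open>2 (conj P z)\<^sub>i\<close>. Since
  \<open>\<Lambda> = D + 2 R z\<close>, this gives \<open>\<Lambda>\<^sup>* = 2 conj P z + T D\<close> with \<open>T P = conj R\<close>, and then
  \<open>[\<Lambda>\<^sub>i, \<Lambda>\<^sub>j\<^sup>*] = 2 (P - R T\<^sup>t)\<^sub>i\<^sub>j = 2 \<rho>\<^sup>2 \<delta>\<^sub>i\<^sub>j\<close> by the choice of \<open>Q\<close>. The vacuum \<open>exp (- \<langle>z, Q z\<rangle>)\<close> is annihilated by all \<open>\<Lambda>\<^sub>i\<close>, so both claims are those of the harmonic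
  oscillator. All operators act on the polynomial multiples of the vacuum, which are dominated by
  Gaussians and rich enough to determine the coefficients of an adjoint operator.
\<close>

section \<open>Integrals of directional derivatives\<close>

text \<open>\<open>adjoint_op\<close> is a definite description, so nothing about \<open>psi\<close>
  can be computed before the adjoint is known to exist and to be unique. Existence concerns all of
  \<open>adjoint_domain\<close>, so the integration by parts has no compact support to lean on, only
  integrability of the density and of its derivatives. Uniqueness needs no density theorem: the
  difference of two candidates maps a polynomial multiple of the vacuum to another one, which can
  then be paired with itself.

  The matrix \<open>T\<close> arises because the adjoint of multiplication by
  \<open>2 (conj P z)\<^sub>k\<close> is \<open>D\<^sub>k\<close>: the term \<open>2 R z\<close>
  must first be written as \<open>R (conj P)\<^sup>-\<^sup>1\<close> applied to
  \<open>2 conj P z\<close>, and conjugating the coefficients gives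
  \<open>T = conj R P\<^sup>-\<^sup>1\<close>.

  A single gap, \<open>\<lambda>\<^sup>2 - \<mu>\<^sup>2 = \<rho>\<^sup>2\<close>, is responsible
  both for the scalar in the commutator and for the Gaussian decay that puts the vacuum into the
  space.\<close>

lemma integrable_gaussian:
  fixes c :: real
  assumes "0 < c"
  shows "integrable lborel (\<lambda>z::'a::euclidean_space. exp (- c * (norm z)\<^sup>2))"
proof -
  \<comment> \<open>The standard deviation for which \<open>exp (- c * x\<^sup>2)\<close> is a
    multiple of a normal density; the n-dimensional integral then factors over the basis.\<close>
  define s where "s = 1 / sqrt (2 * c)"
  have s: "s > 0" "2 * s\<^sup>2 * c = 1" using assms by (auto simp: s_def power_divide)
  have "exp (- c * x\<^sup>2) = sqrt (2 * pi * s\<^sup>2) * normal_density 0 s x" for x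
  proof -
    have "- c * x\<^sup>2 = - x\<^sup>2 / (2 * s\<^sup>2)"
      using s by (simp add: field_simps)
    then show ?thesis using s by (simp add: normal_density_def)
  qed
  then have "integrable lborel (\<lambda>x::real. exp (- c * x\<^sup>2))"
    using s by (simp add: integrable_normal_density)
  then have 1: "(\<integral>\<^sup>+x. ennreal (exp (- c * x\<^sup>2)) \<partial>lborel) < \<infinity>"
    by (subst (asm) integrable_iff_bounded) auto
  have "(\<integral>\<^sup>+z. ennreal (exp (- c * (norm z)\<^sup>2)) \<partial>(lborel :: 'a measure))
      = (\<integral>\<^sup>+z. (\<Prod>b\<in>Basis. ennreal (exp (- c * (z \<bullet> b)\<^sup>2))) \<partial>(lborel :: 'a measure))"
    unfolding norm_eq_sqrt_inner
    by (subst euclidean_inner)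
       (simp add: prod_ennreal exp_sum [symmetric] sum_distrib_left power2_eq_square sum_nonneg)
  also have "\<dots> = (\<Prod>b\<in>(Basis::'a set). (\<integral>\<^sup>+x. ennreal (exp (- c * x\<^sup>2)) \<partial>lborel))"
    by (rule nn_integral_lborel_prod) auto
  also have "\<dots> < \<infinity>" using 1 by (simp add: power_less_top_ennreal)
  finally show ?thesis by (subst integrable_iff_bounded) simp
qed

text \<open>The integral of \<open>h\<close> is the mean over \<open>t \<in> [0, 1]\<close> of its integrals translated by \<open>t v\<close>; by Fubini this
  is the integral of the increment of \<open>g\<close> along \<open>v\<close>, which vanishes by translation invariance.\<close>

lemma integral_directional_derivative_eq_0:
  fixes g h :: "'a::euclidean_space \<Rightarrow> 'b::euclidean_space"
  assumes g: "integrable lborel g" and h: "integrable lborel h" and cont: "continuous_on UNIV h"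
    and deriv: "\<And>x t. ((\<lambda>t. g (x + t *\<^sub>R v)) has_vector_derivative h (x + t *\<^sub>R v)) (at t)"
  shows "integral\<^sup>L lborel h = 0"
proof -
  have shift: "integrable lborel (\<lambda>x. f (x + w))" "(\<integral>x. f (x + w) \<partial>lborel) = integral\<^sup>L lborel f"
    if "integrable lborel f" for f :: "'a \<Rightarrow> 'c::euclidean_space" and w
  proof -
    have f: "f \<in> borel_measurable borel" using borel_measurable_integrable[OF that] by simp
    have "integrable (distr lborel borel ((+) w)) f" using that by (simp add: lborel_distr_plus)
    then show "integrable lborel (\<lambda>x. f (x + w))"
      using f by (subst (asm) integrable_distr_eq) (auto simp: add.commute)
    have "integral\<^sup>L (distr lborel borel ((+) w)) f = integral\<^sup>L lborel (\<lambda>x. f (x + w))"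
      using f by (subst integral_distr) (auto simp: add.commute)
    then show "(\<integral>x. f (x + w) \<partial>lborel) = integral\<^sup>L lborel f" by (simp add: lborel_distr_plus)
  qed
  define k where "k = (\<lambda>t x. indicator {0..1::real} t *\<^sub>R h (x + t *\<^sub>R v))"
  have hm: "h \<in> borel_measurable borel" using cont by (rule borel_measurable_continuous_onI)
  have "(\<lambda>p. snd p + fst p *\<^sub>R v) \<in> borel_measurable (borel :: (real \<times> 'a) measure)"
    by (intro borel_measurable_continuous_onI continuous_intros)
  then have "(\<lambda>p. snd p + fst p *\<^sub>R v) \<in> measurable (lborel \<Otimes>\<^sub>M lborel) borel"
    by (simp add: lborel_prod)
  note this[measurable] hm[measurable]
  have km: "case_prod k \<in> borel_measurable (lborel \<Otimes>\<^sub>M lborel)"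
    unfolding k_def case_prod_beta' by measurable
  \<comment> \<open>Translation invariance makes the integral over \<open>x\<close> independent of
    \<open>t\<close> on the unit interval, which yields joint integrability.\<close>
  have knorm: "(\<integral>x. norm (k t x) \<partial>lborel) = indicator {0..1} t * (\<integral>x. norm (h x) \<partial>lborel)" for t
    using shift(2)[OF integrable_norm[OF h], of "t *\<^sub>R v"] by (simp add: k_def indicator_def)
  have kint: "(\<integral>x. k t x \<partial>lborel) = indicator {0..1} t *\<^sub>R integral\<^sup>L lborel h" for t
    using shift(2)[OF h, of "t *\<^sub>R v"] by (simp add: k_def indicator_def)
  have kp: "integrable (lborel \<Otimes>\<^sub>M lborel) (case_prod k)"
  proof (rule lborel_pair.Fubini_integrable[OF km])
    show "integrable lborel (\<lambda>t. \<integral>x. norm (case_prod k (t, x)) \<partial>lborel)"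
      by (simp add: knorm)
    show "AE t in lborel. integrable lborel (\<lambda>x. case_prod k (t, x))"
      using shift(1)[OF h] by (simp add: k_def)
  qed
  have ftc: "(\<integral>t. k t x \<partial>lborel) = g (x + v) - g x" for x
  proof -
    have "(\<integral>t. k t x \<partial>lborel) = g (x + 1 *\<^sub>R v) - g (x + 0 *\<^sub>R v)"
      unfolding k_def
    proof (rule integral_FTC_atLeastAtMost)
      show "continuous_on {0..1} (\<lambda>t. h (x + t *\<^sub>R v))"
        by (rule continuous_on_compose2[OF cont]) (auto intro!: continuous_intros)
    qed (auto intro: has_vector_derivative_at_within deriv)
    then show ?thesis by simp
  qed
  from lborel_pair.Fubini_integral[OF kp]
  have "(\<integral>x. (\<integral>t. k t x \<partial>lborel) \<partial>lborel) = (\<integral>t. (\<integral>x. k t x \<partial>lborel) \<partial>lborel)" .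
  also have "\<dots> = integral\<^sup>L lborel h" by (simp add: kint)
  finally show ?thesis using g shift[OF g, of v] by (simp add: ftc)
qed

section \<open>Entire functions and their partial derivatives\<close>

text \<open>Complex linearity determines \<open>D\<close> by its values on the vectors
  \<open>axis k 1\<close>, and restricting \<open>F\<close> to a complex coordinate line identifies
  these values with the one-variable derivatives in \<open>pd\<close>.\<close>

lemma entire_has_derivative:
  assumes "entire F"
  shows "(F has_derivative (\<lambda>v. \<Sum>k\<in>UNIV. v $ k * pd k F z)) (at z)"
proof -
  from assms obtain D where D: "(F has_derivative D) (at z)" and hom: "\<And>c v. D (c *s v) = c * D v"
    unfolding entire_def by blast
  have pd: "pd k F z = D (axis k 1)" for k
  proof -
    have ax: "axis k t = t *s axis k (1::complex)" for t by (simp add: vec_eq_iff axis_def)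
    have "((\<lambda>t. z + axis k t) has_derivative (\<lambda>t. axis k t)) (at (0::complex))"
    proof -
      have "bounded_linear (\<lambda>t. axis k t :: complex^'a)"
        by (auto simp: linear_conv_bounded_linear [symmetric] linear_iff axis_def vec_eq_iff)
      from has_derivative_add[OF has_derivative_const bounded_linear_imp_has_derivative[OF this]]
      show ?thesis by simp
    qed
    moreover have "(F has_derivative D) (at (z + axis k 0))" using D by (simp add: axis_def zero_vec_def [symmetric])
    ultimately have F': "((\<lambda>t. F (z + axis k t)) has_derivative (\<lambda>t. D (axis k t))) (at 0)"
      by (rule has_derivative_compose[where f = "\<lambda>t. z + axis k t"])
    have "((\<lambda>t. F (z + axis k t)) has_field_derivative D (axis k 1)) (at 0)"
    proof -
      have "(\<lambda>t. D (axis k t)) = (*) (D (axis k 1))"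
        by (rule ext) (metis ax hom mult.commute)
      with F' show ?thesis by (simp only: has_field_derivative_def)
    qed
    then show ?thesis unfolding pd_def by (rule DERIV_imp_deriv)
  qed
  have expand: "(\<Sum>k\<in>UNIV. v $ k * D (axis k 1)) = D v" for v
  proof -
    interpret linear D using D by (rule has_derivative_linear)
    have "v = (\<Sum>k\<in>UNIV. v $ k *s axis k 1)"
      by (simp add: vec_eq_iff axis_def if_distrib cong: if_cong)
    then have "D v = (\<Sum>k\<in>UNIV. D (v $ k *s axis k 1))" by (metis sum)
    then show ?thesis by (simp only: hom)
  qed
  show ?thesis using D by (simp only: pd expand)
qed

lemma entire_continuous: "entire F \<Longrightarrow> continuous_on UNIV F"
  by (meson continuous_at_imp_continuous_on entire_has_derivative has_derivative_continuous)

text \<open>Uniqueness of the derivative identifies \<open>G k\<close> with \<open>pd k F\<close>,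
  so one derivative computation gives both holomorphy and the partial derivatives in the rules
  below.\<close>

lemma entireI:
  assumes "\<And>z. (F has_derivative (\<lambda>v. \<Sum>k\<in>UNIV. v $ k * G k z)) (at z)"
  shows "entire F" and "pd k F = G k"
proof -
  show F: "entire F"
    unfolding entire_def by (intro allI exI conjI, rule assms) (simp add: sum_distrib_left mult_ac)
  show "pd k F = G k"
  proof
    fix z
    have "(\<Sum>j\<in>UNIV. axis k (1::complex) $ j * pd j F z) = (\<Sum>j\<in>UNIV. axis k (1::complex) $ j * G j z)"
      by (rule fun_cong[OF has_derivative_unique[OF entire_has_derivative[OF F] assms]])
    then show "pd k F z = G k z" by (simp add: axis_def if_distrib if_distribR cong: if_cong)
  qed
qed

lemma
  assumes "entire f" and "entire g"
  shows entire_add: "entire (\<lambda>z. f z + g z)"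
    and pd_add: "pd k (\<lambda>z. f z + g z) = (\<lambda>z. pd k f z + pd k g z)"
proof -
  have "((\<lambda>z. f z + g z) has_derivative (\<lambda>v. \<Sum>k\<in>UNIV. v $ k * (pd k f z + pd k g z))) (at z)" for z
    by (rule has_derivative_eq_rhs[OF has_derivative_add[OF assms[THEN entire_has_derivative]]])
       (simp add: sum.distrib distrib_left)
  from entireI[of "\<lambda>z. f z + g z" "\<lambda>k z. pd k f z + pd k g z", OF this]
  show "entire (\<lambda>z. f z + g z)" "pd k (\<lambda>z. f z + g z) = (\<lambda>z. pd k f z + pd k g z)" by auto
qed

lemma
  assumes "entire f"
  shows entire_scale: "entire (\<lambda>z. c * f z)" and pd_scale: "pd k (\<lambda>z. c * f z) = (\<lambda>z. c * pd k f z)"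
proof -
  have "((\<lambda>z. c * f z) has_derivative (\<lambda>v. \<Sum>k\<in>UNIV. v $ k * (c * pd k f z))) (at z)" for z
    by (rule has_derivative_eq_rhs[OF has_derivative_mult_right[OF entire_has_derivative[OF assms]]])
       (simp add: sum_distrib_left mult_ac)
  from entireI[of "\<lambda>z. c * f z" "\<lambda>k z. c * pd k f z", OF this]
  show "entire (\<lambda>z. c * f z)" "pd k (\<lambda>z. c * f z) = (\<lambda>z. c * pd k f z)" by auto
qed

lemma
  assumes "entire f"
  shows entire_linear: "entire (\<lambda>z. (\<Sum>k\<in>UNIV. b $ k * z $ k) * f z)"
    and pd_linear: "pd i (\<lambda>z. (\<Sum>k\<in>UNIV. b $ k * z $ k) * f z) =
      (\<lambda>z. b $ i * f z + (\<Sum>k\<in>UNIV. b $ k * z $ k) * pd i f z)"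
proof -
  let ?l = "\<lambda>z. \<Sum>k\<in>UNIV. b $ k * z $ k"
  have "((\<lambda>z. ?l z * f z) has_derivative
      (\<lambda>v. \<Sum>k\<in>UNIV. v $ k * (b $ k * f z + ?l z * pd k f z))) (at z)" for z
  proof (rule has_derivative_eq_rhs[OF has_derivative_mult[OF _ entire_has_derivative[OF assms]]])
    show "(?l has_derivative ?l) (at z)"
      by (auto intro!: derivative_eq_intros bounded_linear_imp_has_derivative[OF bounded_linear_vec_nth])
    have "?l v * f z = (\<Sum>k\<in>UNIV. v $ k * (b $ k * f z))" for v
      by (simp add: sum_distrib_left mult_ac)
    moreover have "?l z * (\<Sum>k\<in>UNIV. v $ k * pd k f z) = (\<Sum>k\<in>UNIV. v $ k * (?l z * pd k f z))" for v
      by (simp add: sum_distrib_left[of "?l z"] mult.left_commute)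
    ultimately show "(\<lambda>v. ?l z * (\<Sum>k\<in>UNIV. v $ k * pd k f z) + ?l v * f z) =
      (\<lambda>v. \<Sum>k\<in>UNIV. v $ k * (b $ k * f z + ?l z * pd k f z))"
      by (simp add: distrib_left sum.distrib add.commute)
  qed
  from entireI[of "\<lambda>z. ?l z * f z" "\<lambda>k z. b $ k * f z + ?l z * pd k f z", OF this]
  show "entire (\<lambda>z. ?l z * f z)" "pd i (\<lambda>z. ?l z * f z) = (\<lambda>z. b $ i * f z + ?l z * pd i f z)" by auto
qed

lemma
  assumes "entire f"
  shows entire_coord: "entire (\<lambda>z. z $ j * f z)"
    and pd_coord: "pd k (\<lambda>z. z $ j * f z) = (\<lambda>z. (if k = j then f z else 0) + z $ j * pd k f z)"
  using entire_linear[OF assms, of "axis j 1"] pd_linear[OF assms, of k "axis j 1"]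
  by (simp_all add: axis_def if_distrib if_distribR fun_eq_iff cong: if_cong)

lemma bilin_mv: "bilin v (M *v w) = (\<Sum>i\<in>UNIV. v $ i * (\<Sum>j\<in>UNIV. M $ i $ j * w $ j))"
  by (simp add: bilin_def matrix_vector_mult_def)

lemma bilin_transpose: "bilin v (M *v w) = bilin w (transpose M *v v)"
  unfolding bilin_mv sum_distrib_left
  by (subst sum.swap) (simp add: transpose_def mult_ac)

text \<open>Real derivatives and two separate arguments let the same rule serve the holomorphic form
  in the vacuum and the weight, where \<open>cnj_vec\<close> enters.\<close>

lemma has_derivative_bilin_mv:
  assumes f: "(f has_derivative f') (at z within A)" and g: "(g has_derivative g') (at z within A)"
  shows "((\<lambda>z. bilin (f z) (M *v g z)) has_derivative
    (\<lambda>v. bilin (f' v) (M *v g z) + bilin (f z) (M *v g' v))) (at z within A)"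
proof -
  have nth: "((\<lambda>z. h z $ i) has_derivative (\<lambda>v. h' v $ i)) (at z within A)"
    if "(h has_derivative h') (at z within A)" for h h' :: "'a \<Rightarrow> complex^'m" and i
    using that by (rule bounded_linear.has_derivative[OF bounded_linear_vec_nth])
  show ?thesis
    unfolding bilin_mv
    by (auto intro!: derivative_eq_intros nth[OF f] nth[OF g] simp: fun_eq_iff sum.distrib)
qed

lemma
  assumes "transpose Q = Q"
  shows entire_psi0: "entire (psi0 Q)"
    and pd_psi0: "pd k (psi0 Q) = (\<lambda>z. - 2 * (Q *v z) $ k * psi0 Q z)"
proof -
  have "(psi0 Q has_derivative (\<lambda>v. \<Sum>k\<in>UNIV. v $ k * (- 2 * (Q *v z) $ k * psi0 Q z))) (at z)" for z
  proof -
    have "((\<lambda>z. bilin z (Q *v z)) has_derivative (\<lambda>v. bilin v (Q *v z) + bilin z (Q *v v))) (at z)"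
      by (intro has_derivative_bilin_mv has_derivative_ident)
    from has_derivative_compose[OF has_derivative_minus[OF this] DERIV_exp[unfolded has_field_derivative_def]]
    have "(psi0 Q has_derivative (\<lambda>v. psi0 Q z * - (bilin v (Q *v z) + bilin z (Q *v v)))) (at z)"
      unfolding psi0_def .
    moreover have "bilin z (Q *v v) = bilin v (Q *v z)" for v
      using bilin_transpose[of z Q v] unfolding assms .
    then have "psi0 Q z * - (bilin v (Q *v z) + bilin z (Q *v v))
        = (\<Sum>k\<in>UNIV. v $ k * (- 2 * (Q *v z) $ k * psi0 Q z))" for v
      by (simp add: bilin_def sum_distrib_left mult_ac flip: sum_negf)
    ultimately show ?thesis by simp
  qed
  from entireI[of "psi0 Q" "\<lambda>k z. - 2 * (Q *v z) $ k * psi0 Q z", OF this]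
  show "entire (psi0 Q)" "pd k (psi0 Q) = (\<lambda>z. - 2 * (Q *v z) $ k * psi0 Q z)" by auto
qed

section \<open>Polynomial multiples of the vacuum\<close>

text \<open>Generating the polynomial multiples of the vacuum by closure rules replaces a theory of
  multivariate polynomials by rule induction.\<close>

inductive_set gauss_poly :: "complex^'n^'n \<Rightarrow> (complex^'n \<Rightarrow> complex) set" for Q where
  gp_psi0: "psi0 Q \<in> gauss_poly Q"
| gp_add: "f \<in> gauss_poly Q \<Longrightarrow> g \<in> gauss_poly Q \<Longrightarrow> (\<lambda>z. f z + g z) \<in> gauss_poly Q"
| gp_scale: "f \<in> gauss_poly Q \<Longrightarrow> (\<lambda>z. c * f z) \<in> gauss_poly Q"
| gp_coord: "f \<in> gauss_poly Q \<Longrightarrow> (\<lambda>z. z $ j * f z) \<in> gauss_poly Q"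

lemma gp_zero: "(\<lambda>z. 0) \<in> gauss_poly Q"
  using gp_scale[OF gp_psi0, of 0] by simp

lemma gp_sum: "(\<And>i. i \<in> I \<Longrightarrow> f i \<in> gauss_poly Q) \<Longrightarrow> (\<lambda>z. \<Sum>i\<in>I. f i z) \<in> gauss_poly Q"
  by (induction I rule: infinite_finite_induct) (auto intro: gp_zero gp_add)

lemma gp_linear:
  assumes "f \<in> gauss_poly Q"
  shows "(\<lambda>z. (\<Sum>k\<in>UNIV. b $ k * z $ k) * f z) \<in> gauss_poly Q"
  using gp_sum[of UNIV "\<lambda>k z. b $ k * (z $ k * f z)" Q] assms
  by (simp add: gp_scale gp_coord sum_distrib_right mult.assoc)

lemma gp_entire:
  assumes "transpose Q = Q" and "f \<in> gauss_poly Q"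
  shows "entire f"
  using assms(2,1)
  by (induction rule: gauss_poly.induct) (auto intro: entire_psi0 entire_add entire_scale entire_coord)

lemma gp_pd:
  assumes "transpose Q = Q" and "f \<in> gauss_poly Q"
  shows "pd k f \<in> gauss_poly Q"
  using assms(2)
proof induction
  case gp_psi0
  show ?case
    using gp_scale[OF gp_linear[OF gauss_poly.gp_psi0, of "Q $ k" Q], of "-2"]
    by (simp add: pd_psi0[OF assms(1)] matrix_vector_mult_def mult.assoc)
next
  case (gp_coord f j)
  have "(\<lambda>z. if k = j then f z else 0) \<in> gauss_poly Q" using gp_coord gp_zero by (cases "k = j") auto
  from gp_add[OF this gauss_poly.gp_coord[OF gp_coord.IH]] show ?case
    by (simp add: pd_coord gp_entire[OF assms(1) gp_coord.hyps])
qed (simp_all add: pd_add pd_scale gp_entire[OF assms(1)] gauss_poly.intros)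

text \<open>Rule induction takes the place of a general theorem on mixed partials: on the vacuum the
  claim is the symmetry of \<open>Q\<close>, and every closure rule preserves it.\<close>

lemma gp_pd_commute:
  assumes "transpose Q = Q" and "f \<in> gauss_poly Q"
  shows "pd i (pd j f) = pd j (pd i f)"
  using assms(2)
proof induction
  case gp_psi0
  have pd2: "pd i (pd j (psi0 Q)) =
      (\<lambda>z. - 2 * Q $ j $ i * psi0 Q z + 4 * (Q *v z) $ j * (Q *v z) $ i * psi0 Q z)" for i j
    using pd_linear[OF entire_psi0[OF assms(1)], of i "- 2 *s Q $ j"]
    by (simp add: pd_psi0[OF assms(1)] matrix_vector_mult_def sum_distrib_left [symmetric] sum_negf
        mult.assoc fun_eq_iff)
  have "Q $ i $ j = Q $ j $ i"
    using assms(1) by (metis (mono_tags, lifting) transpose_def vec_lambda_beta)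
  then show ?case by (simp add: pd2 mult_ac)
next
  case (gp_add f g)
  then show ?case by (simp add: pd_add gp_entire[OF assms(1)] gp_pd[OF assms(1)])
next
  case (gp_scale f c)
  then show ?case by (simp add: pd_scale gp_entire[OF assms(1)] gp_pd[OF assms(1)])
next
  case (gp_coord f l)
  have e: "entire f" "\<And>k. entire (pd k f)"
    using gp_entire[OF assms(1)] gp_pd[OF assms(1)] gp_coord.hyps by auto
  have "entire (\<lambda>z. if k = l then f z else 0)" for k
    using e(1) gp_entire[OF assms(1) gp_zero] by (cases "k = l") auto
  then have "pd k (pd m (\<lambda>z. z $ l * f z)) =
     (\<lambda>z. (if m = l then pd k f z else 0) + ((if k = l then pd m f z else 0) + z $ l * pd k (pd m f) z))" for k m
    \<comment> \<open>The factor 0 in \<open>pd_scale\<close> supplies the derivative of the zero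
      function coming from the \<open>else\<close> branch.\<close>
    using gp_zero[of Q] pd_scale[of f _ 0] e
    by (cases "m = l"; cases "k = l") (simp_all add: pd_coord pd_add entire_coord)
  then show ?case by (simp add: gp_coord.IH fun_eq_iff)
qed

text \<open>A coordinate factor is absorbed by half of the exponent \<open>\<epsilon>\<close>, so
  the induction must keep \<open>\<epsilon>\<close> arbitrary.\<close>

lemma gp_growth:
  assumes "f \<in> gauss_poly Q" and "0 < \<epsilon>"
  shows "\<exists>K. \<forall>z. cmod (f z) \<le> K * exp (\<epsilon> * (norm z)\<^sup>2) * cmod (psi0 Q z)"
  using assms
proof (induction arbitrary: \<epsilon>)
  case gp_psi0
  then show ?case by (intro exI[of _ 1]) (simp add: mult_le_cancel_right1)
next
  case (gp_add f g)
  then obtain K L where "\<And>z. cmod (f z) \<le> K * exp (\<epsilon> * (norm z)\<^sup>2) * cmod (psi0 Q z)"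
    "\<And>z. cmod (g z) \<le> L * exp (\<epsilon> * (norm z)\<^sup>2) * cmod (psi0 Q z)" by meson
  then have "cmod (f z + g z) \<le> (K + L) * exp (\<epsilon> * (norm z)\<^sup>2) * cmod (psi0 Q z)" for z
    unfolding distrib_right by (meson add_mono norm_triangle_le)
  then show ?case by blast
next
  case (gp_scale f c)
  then obtain K where "\<And>z. cmod (f z) \<le> K * exp (\<epsilon> * (norm z)\<^sup>2) * cmod (psi0 Q z)" by meson
  then have "cmod (c * f z) \<le> (cmod c * K) * exp (\<epsilon> * (norm z)\<^sup>2) * cmod (psi0 Q z)" for z
    unfolding norm_mult mult.assoc by (intro mult_left_mono) (auto simp: mult.assoc)
  then show ?case by blast
next
  case (gp_coord f j)
  then obtain K where K: "\<And>z. cmod (f z) \<le> K * exp (\<epsilon> / 2 * (norm z)\<^sup>2) * cmod (psi0 Q z)"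
    by (meson half_gt_zero)
  have "0 \<le> K" using order_trans[OF norm_ge_zero K, of 0] by (simp add: psi0_def zero_le_mult_iff)
  have "cmod (z $ j * f z) \<le> ((1 + 2 / \<epsilon>) * K) * exp (\<epsilon> * (norm z)\<^sup>2) * cmod (psi0 Q z)" for z
  proof -
    have "cmod (z $ j) \<le> norm z" by (rule Finite_Cartesian_Product.norm_nth_le)
    also have "\<dots> \<le> 1 + (norm z)\<^sup>2"
      using zero_le_power2[of "norm z - 1/2"] by (simp add: power2_diff power_divide)
    \<comment> \<open>The constant is chosen so that the expanded product contains both terms of the
      left side plus positive ones; then \<open>1 + x \<le> exp x\<close> applies.\<close>
    also have "\<dots> \<le> (1 + 2 / \<epsilon>) * (1 + \<epsilon> / 2 * (norm z)\<^sup>2)"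
      using gp_coord.prems by (simp add: field_simps)
    also have "\<dots> \<le> (1 + 2 / \<epsilon>) * exp (\<epsilon> / 2 * (norm z)\<^sup>2)"
      using gp_coord.prems by (intro mult_left_mono exp_ge_add_one_self) auto
    finally have "cmod (z $ j * f z) \<le> ((1 + 2 / \<epsilon>) * exp (\<epsilon> / 2 * (norm z)\<^sup>2)) *
        (K * exp (\<epsilon> / 2 * (norm z)\<^sup>2) * cmod (psi0 Q z))"
      unfolding norm_mult using gp_coord.prems K by (intro mult_mono) auto
    also have "\<dots> = ((1 + 2 / \<epsilon>) * K) * (exp (\<epsilon> / 2 * (norm z)\<^sup>2) * exp (\<epsilon> / 2 * (norm z)\<^sup>2)) * cmod (psi0 Q z)"
      by (simp add: mult_ac)
    finally show ?thesis by (simp flip: exp_add)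
  qed
  then show ?case by blast
qed

section \<open>The weighted inner product\<close>

definition H_density ::
  "(complex^'n \<Rightarrow> real) \<Rightarrow> (complex^'n \<Rightarrow> complex) \<Rightarrow> (complex^'n \<Rightarrow> complex) \<Rightarrow> complex^'n \<Rightarrow> complex" where
  "H_density \<Phi> F G z = F z * cnj (G z) * complex_of_real (exp (- 2 * \<Phi> z))"

lemma H_inner_eq_integral: "H_inner \<Phi> F G = integral\<^sup>L lborel (H_density \<Phi> F G)"
  by (simp add: H_inner_def H_density_def [abs_def])

lemma H_inner_cnj: "H_inner \<Phi> G F = cnj (H_inner \<Phi> F G)"
  unfolding H_inner_def by (simp add: mult_ac flip: Bochner_Integration.integral_cnj)

lemma H_inner_scale: "H_inner \<Phi> (\<lambda>z. c * F z) G = c * H_inner \<Phi> F G"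
  unfolding H_inner_def by (subst integral_mult_right_zero [symmetric]) (simp add: mult_ac)

lemma H_inner_self_integral:
  "H_inner \<Phi> F F = complex_of_real (\<integral>z. (cmod (F z))\<^sup>2 * exp (- 2 * \<Phi> z) \<partial>lborel)"
  unfolding H_inner_def complex_norm_square [symmetric] by (simp flip: of_real_mult of_real_power)

lemma H_inner_self: "H_inner \<Phi> F F = complex_of_real ((H_norm \<Phi> F)\<^sup>2)"
proof -
  have "0 \<le> (\<integral>z. (cmod (F z))\<^sup>2 * exp (- 2 * \<Phi> z) \<partial>lborel)" by (rule integral_nonneg_AE) auto
  then show ?thesis by (simp add: H_norm_def H_inner_self_integral)
qed

locale continuous_weight =
  fixes \<Phi> :: "complex^'n \<Rightarrow> real"
  assumes weight_continuous: "continuous_on UNIV \<Phi>"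
begin

lemma H_density_continuous:
  "entire F \<Longrightarrow> entire G \<Longrightarrow> continuous_on UNIV (H_density \<Phi> F G)"
  unfolding H_density_def [abs_def]
  by (intro continuous_intros entire_continuous weight_continuous)

lemma H_density_integrable:
  assumes "F \<in> H_space \<Phi>" and "G \<in> H_space \<Phi>"
  shows "integrable lborel (H_density \<Phi> F G)"
proof (rule Bochner_Integration.integrable_bound)
  show "integrable lborel (\<lambda>z. (cmod (F z))\<^sup>2 * exp (- 2 * \<Phi> z) + (cmod (G z))\<^sup>2 * exp (- 2 * \<Phi> z))"
    using assms by (auto simp: H_space_def)
  show "H_density \<Phi> F G \<in> borel_measurable lborel"
    using assms borel_measurable_continuous_onI[OF H_density_continuous] by (auto simp: H_space_def)
  have "cmod (F z) * cmod (G z) * exp (- 2 * \<Phi> z) \<le> ((cmod (F z))\<^sup>2 + (cmod (G z))\<^sup>2) * exp (- 2 * \<Phi> z)" for z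
  proof (rule mult_right_mono)
    have "0 \<le> cmod (F z) * cmod (G z)" by simp
    then show "cmod (F z) * cmod (G z) \<le> (cmod (F z))\<^sup>2 + (cmod (G z))\<^sup>2"
      using sum_squares_bound[of "cmod (F z)" "cmod (G z)"] by linarith
  qed simp
  then have "norm (H_density \<Phi> F G z)
      \<le> (cmod (F z))\<^sup>2 * exp (- 2 * \<Phi> z) + (cmod (G z))\<^sup>2 * exp (- 2 * \<Phi> z)" for z
    by (simp add: H_density_def norm_mult distrib_right)
  then show "AE z in lborel. norm (H_density \<Phi> F G z)
      \<le> norm ((cmod (F z))\<^sup>2 * exp (- 2 * \<Phi> z) + (cmod (G z))\<^sup>2 * exp (- 2 * \<Phi> z))"
    using order_trans[OF _ abs_ge_self] by (auto intro!: AE_I2)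
qed

lemma H_space_add:
  assumes "F \<in> H_space \<Phi>" and "G \<in> H_space \<Phi>"
  shows "(\<lambda>z. F z + G z) \<in> H_space \<Phi>"
proof -
  have "complex_of_real ((cmod (F z + G z))\<^sup>2 * exp (- 2 * \<Phi> z)) =
      H_density \<Phi> F F z + H_density \<Phi> F G z + H_density \<Phi> G F z + H_density \<Phi> G G z" for z
    unfolding H_density_def of_real_mult complex_norm_square by (simp add: algebra_simps)
  moreover have "integrable lborel (\<lambda>z. H_density \<Phi> F F z + H_density \<Phi> F G z + H_density \<Phi> G F z + H_density \<Phi> G G z)"
    by (intro Bochner_Integration.integrable_add H_density_integrable assms)
  ultimately have "integrable lborel (\<lambda>z. complex_of_real ((cmod (F z + G z))\<^sup>2 * exp (- 2 * \<Phi> z)))"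
    by (simp only:)
  then have "integrable lborel (\<lambda>z. (cmod (F z + G z))\<^sup>2 * exp (- 2 * \<Phi> z))"
    by (simp only: complex_of_real_integrable_eq)
  then show ?thesis using assms by (simp add: H_space_def entire_add)
qed

lemma H_space_scale:
  assumes "F \<in> H_space \<Phi>"
  shows "(\<lambda>z. c * F z) \<in> H_space \<Phi>"
  using assms by (simp add: H_space_def entire_scale norm_mult power_mult_distrib mult.assoc)

lemma H_space_sum:
  assumes "\<And>k. k \<in> I \<Longrightarrow> F k \<in> H_space \<Phi>"
  shows "(\<lambda>z. \<Sum>k\<in>I. F k z) \<in> H_space \<Phi>"
proof -
  have "entire (\<lambda>z. 0)" unfolding entire_def by (intro allI exI[of _ "\<lambda>v. 0"]) auto
  then have "(\<lambda>z. 0) \<in> H_space \<Phi>" by (simp add: H_space_def)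
  with assms show ?thesis
    by (induction I rule: infinite_finite_induct) (auto intro: H_space_add)
qed

lemma H_inner_add:
  assumes "F \<in> H_space \<Phi>" and "G \<in> H_space \<Phi>" and "K \<in> H_space \<Phi>"
  shows "H_inner \<Phi> (\<lambda>z. F z + G z) K = H_inner \<Phi> F K + H_inner \<Phi> G K"
proof -
  have "H_density \<Phi> (\<lambda>z. F z + G z) K = (\<lambda>z. H_density \<Phi> F K z + H_density \<Phi> G K z)"
    by (simp add: H_density_def fun_eq_iff distrib_right)
  then show ?thesis unfolding H_inner_eq_integral
    using Bochner_Integration.integral_add[OF H_density_integrable H_density_integrable, OF assms(1,3,2,3)] by simp
qed

lemma H_inner_sum:
  assumes "\<And>k. k \<in> I \<Longrightarrow> F k \<in> H_space \<Phi>" and "K \<in> H_space \<Phi>"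
  shows "H_inner \<Phi> (\<lambda>z. \<Sum>k\<in>I. F k z) K = (\<Sum>k\<in>I. H_inner \<Phi> (F k) K)"
proof -
  have "H_density \<Phi> (\<lambda>z. \<Sum>k\<in>I. F k z) K = (\<lambda>z. \<Sum>k\<in>I. H_density \<Phi> (F k) K z)"
    by (simp add: H_density_def fun_eq_iff sum_distrib_right)
  then show ?thesis unfolding H_inner_eq_integral
    using Bochner_Integration.integral_sum[of I lborel "\<lambda>k. H_density \<Phi> (F k) K"] H_density_integrable assms
    by simp
qed

text \<open>Membership of \<open>F\<close> in \<open>adjoint_domain\<close> makes each summand
  square integrable, which permits splitting the integral.\<close>

lemma H_inner_first_order:
  assumes F: "F \<in> adjoint_domain \<Phi>" and G: "G \<in> H_space \<Phi>"
  shows "H_inner \<Phi> (first_order_op a b c F) G =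
      (\<Sum>k\<in>UNIV. a $ k * H_inner \<Phi> (pd k F) G) +
      (\<Sum>k\<in>UNIV. b $ k * H_inner \<Phi> (\<lambda>z. z $ k * F z) G) + c * H_inner \<Phi> F G"
proof -
  have eq: "first_order_op a b c F =
    (\<lambda>z. (\<Sum>k\<in>UNIV. a $ k * pd k F z) + (\<Sum>k\<in>UNIV. b $ k * (z $ k * F z)) + c * F z)"
    by (simp add: fun_eq_iff first_order_op_def sum_distrib_right mult.assoc)
  have H: "(\<lambda>z. a $ k * pd k F z) \<in> H_space \<Phi>" "(\<lambda>z. b $ k * (z $ k * F z)) \<in> H_space \<Phi>"
    "(\<lambda>z. c * F z) \<in> H_space \<Phi>" for k
    using F by (auto simp: adjoint_domain_def intro: H_space_scale)
  then have H': "(\<lambda>z. \<Sum>k\<in>UNIV. a $ k * pd k F z) \<in> H_space \<Phi>"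
    "(\<lambda>z. \<Sum>k\<in>UNIV. b $ k * (z $ k * F z)) \<in> H_space \<Phi>"
    by (auto intro: H_space_sum)
  show ?thesis
    unfolding eq using G H H'
    by (simp add: H_inner_add H_space_add H_inner_sum H_inner_scale)
qed

end

section \<open>Integration by parts and commutators\<close>

lemma integral_gradient_eq_0:
  fixes g h :: "complex^'n \<Rightarrow> complex"
  assumes "integrable lborel g" and "continuous_on UNIV h" and "integrable lborel h"
    and "\<And>z. (g has_derivative D z) (at z)" and "\<And>z. D z v = h z"
  shows "integral\<^sup>L lborel h = 0"
proof (rule integral_directional_derivative_eq_0[OF assms(1,3,2)])
  fix x and t :: real
  have "((\<lambda>t. x + t *\<^sub>R v) has_derivative (\<lambda>s. s *\<^sub>R v)) (at t)"
    by (auto intro!: derivative_eq_intros)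
  from has_derivative_compose[OF this assms(4)]
  have "((\<lambda>t. g (x + t *\<^sub>R v)) has_derivative (\<lambda>s. D (x + t *\<^sub>R v) (s *\<^sub>R v))) (at t)" .
  moreover have "D y (s *\<^sub>R v) = s *\<^sub>R h y" for y s
    using linear_scale[OF has_derivative_linear[OF assms(4)]] by (simp add: assms(5))
  ultimately show "((\<lambda>t. g (x + t *\<^sub>R v)) has_vector_derivative h (x + t *\<^sub>R v)) (at t)"
    by (simp add: has_vector_derivative_def)
qed

locale quadratic_weight =
  fixes P S :: "complex^'n^'n"
  assumes P_herm: "adjoint_mat P = P" and S_sym: "transpose S = S"
begin

definition wt :: "complex^'n \<Rightarrow> real" where
  "wt z = Re (bilin z (P *v cnj_vec z)) + Re (bilin z (S *v z))"

text \<open>The Wirtinger derivative of \<open>wt\<close> with respect to the k-th coordinate, given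
  that \<open>P\<close> is Hermitian and \<open>S\<close> symmetric.\<close>

definition grad :: "'n \<Rightarrow> complex^'n \<Rightarrow> complex" where
  "grad k z = (\<Sum>j\<in>UNIV. P $ k $ j * cnj (z $ j)) + (\<Sum>j\<in>UNIV. S $ k $ j * z $ j)"

lemma P_cnj: "cnj (P $ i $ j) = P $ j $ i"
proof -
  have "adjoint_mat P $ j $ i = cnj (P $ i $ j)"
    by (simp add: adjoint_mat_def cnj_mat_def map_matrix_def transpose_def)
  then show ?thesis by (simp add: P_herm)
qed

text \<open>The product rule gives two terms for each form. They are conjugate for Hermitian
  \<open>P\<close> and equal for symmetric \<open>S\<close>, hence the doubled real part.\<close>

lemma wt_has_derivative:
  "(wt has_derivative (\<lambda>v. 2 * Re (\<Sum>k\<in>UNIV. v $ k * grad k z))) (at z)"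
proof -
  have "bounded_linear (cnj_vec :: complex^'n \<Rightarrow> complex^'n)"
    by (auto simp: linear_conv_bounded_linear [symmetric] linear_iff cnj_vec_def vec_eq_iff)
  then have c: "(cnj_vec has_derivative cnj_vec) (at z)" for z :: "complex^'n"
    by (rule bounded_linear_imp_has_derivative)
  have 1: "((\<lambda>z. Re (bilin z (P *v cnj_vec z))) has_derivative
      (\<lambda>v. Re (bilin v (P *v cnj_vec z) + bilin z (P *v cnj_vec v)))) (at z)"
    by (intro bounded_linear.has_derivative[OF bounded_linear_Re] has_derivative_bilin_mv has_derivative_ident c)
  have 2: "((\<lambda>z. Re (bilin z (S *v z))) has_derivative
      (\<lambda>v. Re (bilin v (S *v z) + bilin z (S *v v)))) (at z)"
    by (intro bounded_linear.has_derivative[OF bounded_linear_Re] has_derivative_bilin_mv has_derivative_ident)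
  have "bilin z (P *v cnj_vec v) = cnj (bilin v (P *v cnj_vec z))" for v
    unfolding bilin_mv sum_distrib_left cnj_sum
    by (subst sum.swap) (simp add: cnj_vec_def P_cnj mult_ac)
  moreover have "bilin z (S *v v) = bilin v (S *v z)" for v
    using bilin_transpose[of z S v] unfolding S_sym .
  moreover have "(\<Sum>k\<in>UNIV. v $ k * grad k z) = bilin v (P *v cnj_vec z) + bilin v (S *v z)" for v
    by (simp add: bilin_mv grad_def cnj_vec_def distrib_left sum.distrib)
  ultimately show ?thesis
    using has_derivative_add[OF 1 2] by (simp add: wt_def [abs_def])
qed

sublocale continuous_weight wt
  by unfold_locales
    (meson continuous_at_imp_continuous_on has_derivative_continuous wt_has_derivative)

text \<open>The two sums are the complex linear and antilinear parts, with Wirtinger derivatives as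
  coefficients. The holomorphic \<open>F\<close> enters only the first with a derivative, the
  conjugate of \<open>G\<close> only the second, and the weight both.\<close>

lemma H_density_has_derivative:
  assumes "entire F" and "entire G"
  shows "(H_density wt F G has_derivative (\<lambda>v. (\<Sum>k\<in>UNIV. v $ k *
      (H_density wt (pd k F) G z - 2 * grad k z * H_density wt F G z))
    + (\<Sum>k\<in>UNIV. cnj (v $ k) * (H_density wt F (pd k G) z - 2 * cnj (grad k z) * H_density wt F G z)))) (at z)"
proof -
  have "((\<lambda>z. exp (- 2 * wt z)) has_derivative
      (\<lambda>v. (- 2 * (2 * Re (\<Sum>k\<in>UNIV. v $ k * grad k z))) * exp (- 2 * wt z))) (at z)"
    using DERIV_compose_FDERIV[OF DERIV_exp has_derivative_mult_right[OF wt_has_derivative]] .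
  from has_derivative_mult[OF has_derivative_mult[OF entire_has_derivative[OF assms(1)]
        bounded_linear.has_derivative[OF bounded_linear_cnj entire_has_derivative[OF assms(2)]]]
      bounded_linear.has_derivative[OF bounded_linear_of_real this]]
  show ?thesis
    unfolding H_density_def [abs_def]
  proof (elim has_derivative_eq_rhs, intro ext)
    fix v :: "complex^'n"
    have re: "complex_of_real (2 * Re w) = w + cnj w" for w
      by (simp add: complex_add_cnj)
    show "F z * cnj (G z) * complex_of_real (- 2 * (2 * Re (\<Sum>k\<in>UNIV. v $ k * grad k z)) * exp (- 2 * wt z)) +
      (F z * cnj (\<Sum>k\<in>UNIV. v $ k * pd k G z) + (\<Sum>k\<in>UNIV. v $ k * pd k F z) * cnj (G z)) *
        complex_of_real (exp (- 2 * wt z)) =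
      (\<Sum>k\<in>UNIV. v $ k * (pd k F z * cnj (G z) * complex_of_real (exp (- 2 * wt z)) -
          2 * grad k z * (F z * cnj (G z) * complex_of_real (exp (- 2 * wt z))))) +
      (\<Sum>k\<in>UNIV. cnj (v $ k) * (F z * cnj (pd k G z) * complex_of_real (exp (- 2 * wt z)) -
          2 * cnj (grad k z) * (F z * cnj (G z) * complex_of_real (exp (- 2 * wt z)))))"
      unfolding of_real_mult[of "- 2 * (2 * _)"] of_real_mult[of "- 2"] re
      by (simp add: sum_distrib_left sum_distrib_right sum.distrib sum_subtractf sum_negf algebra_simps)
  qed
qed

text \<open>The holomorphic Wirtinger derivative of the density integrates to 0, and no derivative
  of \<open>G\<close> occurs in it. In the term from \<open>grad\<close>, the conjugate coordinates
  are absorbed into \<open>G\<close> and the coordinates into \<open>F\<close>.\<close>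

lemma H_inner_pd:
  assumes F: "F \<in> adjoint_domain wt" and G: "G \<in> adjoint_domain wt"
  shows "H_inner wt (pd i F) G = 2 * (\<Sum>k\<in>UNIV. P $ i $ k * H_inner wt F (\<lambda>z. z $ k * G z))
    + 2 * (\<Sum>k\<in>UNIV. S $ i $ k * H_inner wt (\<lambda>z. z $ k * F z) G)"
proof -
  let ?d = "H_density wt"
  have H: "F \<in> H_space wt" "G \<in> H_space wt" "\<And>k. pd k F \<in> H_space wt" "\<And>k. pd k G \<in> H_space wt"
    "\<And>k. (\<lambda>z. z $ k * F z) \<in> H_space wt" "\<And>k. (\<lambda>z. z $ k * G z) \<in> H_space wt"
    using F G by (auto simp: adjoint_domain_def)
  then have e: "entire F" "entire G" "\<And>k. entire (pd k F)" "\<And>k. entire (pd k G)"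
    by (auto simp: H_space_def)
  define A where "A z = ?d (pd i F) G z - 2 * grad i z * ?d F G z" for z
  define B where "B z = ?d F (pd i G) z - 2 * cnj (grad i z) * ?d F G z" for z
  have A: "A = (\<lambda>z. ?d (pd i F) G z - (2 * (\<Sum>k\<in>UNIV. P $ i $ k * ?d F (\<lambda>z. z $ k * G z) z)
      + 2 * (\<Sum>k\<in>UNIV. S $ i $ k * ?d (\<lambda>z. z $ k * F z) G z)))"
    by (simp add: fun_eq_iff A_def grad_def H_density_def sum_distrib_left sum_distrib_right distrib_left
        distrib_right mult_ac)
  have B: "B = (\<lambda>z. ?d F (pd i G) z - (2 * (\<Sum>k\<in>UNIV. cnj (P $ i $ k) * ?d (\<lambda>z. z $ k * F z) G z)
      + 2 * (\<Sum>k\<in>UNIV. cnj (S $ i $ k) * ?d F (\<lambda>z. z $ k * G z) z)))"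
    by (simp add: fun_eq_iff B_def grad_def H_density_def sum_distrib_left sum_distrib_right distrib_left
        distrib_right mult_ac)
  have intA: "integrable lborel A" unfolding A
    by (intro Bochner_Integration.integrable_diff Bochner_Integration.integrable_add
        integrable_mult_right Bochner_Integration.integrable_sum H_density_integrable H)
  have intB: "integrable lborel B" unfolding B
    by (intro Bochner_Integration.integrable_diff Bochner_Integration.integrable_add
        integrable_mult_right Bochner_Integration.integrable_sum H_density_integrable H)
  have "continuous_on UNIV (grad i)" unfolding grad_def [abs_def] by (intro continuous_intros)
  then have cont: "continuous_on UNIV A" "continuous_on UNIV B"
    unfolding A_def [abs_def] B_def [abs_def]
    by (auto intro!: continuous_intros H_density_continuous e)
  have 0: "u * integral\<^sup>L lborel A + cnj u * integral\<^sup>L lborel B = 0" for u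
  proof -
    have "integral\<^sup>L lborel (\<lambda>z. u * A z + cnj u * B z) = 0"
    proof (rule integral_gradient_eq_0[where v = "axis i u", OF H_density_integrable[OF H(1,2)]])
      show "(\<Sum>k\<in>UNIV. axis i u $ k * (?d (pd k F) G z - 2 * grad k z * ?d F G z)) +
        (\<Sum>k\<in>UNIV. cnj (axis i u $ k) * (?d F (pd k G) z - 2 * cnj (grad k z) * ?d F G z)) =
        u * A z + cnj u * B z" for z
        by (simp add: A_def B_def axis_def if_distrib if_distribR cong: if_cong)
    qed (auto intro!: continuous_intros cont intA intB H_density_has_derivative e)
    then show ?thesis using intA intB by simp
  qed
  \<comment> \<open>The real directions \<open>1\<close> and \<open>\<i>\<close> give
    \<open>A + B = 0\<close> and \<open>A - B = 0\<close> for the integrals, which separates the two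
    Wirtinger parts.\<close>
  have "integral\<^sup>L lborel A = 0" using 0[of 1] 0[of \<i>] by (simp add: algebra_simps add_eq_0_iff)
  moreover have "integral\<^sup>L lborel A = H_inner wt (pd i F) G - (2 * (\<Sum>k\<in>UNIV. P $ i $ k * H_inner wt F (\<lambda>z. z $ k * G z))
      + 2 * (\<Sum>k\<in>UNIV. S $ i $ k * H_inner wt (\<lambda>z. z $ k * F z) G))"
    unfolding A H_inner_eq_integral using H_density_integrable H
    by (simp add: Bochner_Integration.integral_sum)
  ultimately show ?thesis by simp
qed

end

lemma Lambda_first_order: "Lambda Q i = first_order_op (axis i 1) (2 *s Q $ i) 0"
  by (simp add: fun_eq_iff Lambda_def first_order_op_def axis_def if_distrib if_distribR
      sum_distrib_left mult.assoc cong: if_cong)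

lemma gp_first_order:
  assumes "transpose Q = Q" and "f \<in> gauss_poly Q"
  shows "first_order_op a b c f \<in> gauss_poly Q"
  unfolding first_order_op_def [abs_def]
  by (intro gp_add gp_sum gp_scale gp_linear gp_pd assms)

lemma pd_first_order:
  assumes "transpose Q = Q" and "f \<in> gauss_poly Q"
  shows "pd i (first_order_op a b 0 f) = (\<lambda>z. first_order_op a b 0 (pd i f) z + b $ i * f z)"
proof -
  note [simp] = gp_entire[OF assms(1)]
  have sum: "entire (\<lambda>z. \<Sum>k\<in>I. g k z) \<and> pd i (\<lambda>z. \<Sum>k\<in>I. g k z) = (\<lambda>z. \<Sum>k\<in>I. pd i (g k) z)"
    if "finite I" "\<And>k. k \<in> I \<Longrightarrow> g k \<in> gauss_poly Q" for g and I :: "'a set"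
    using that
  proof (induction I)
    case empty
    then show ?case using gp_entire[OF assms(1) gp_zero] pd_scale[OF entire_psi0[OF assms(1)], of i 0] by simp
  next
    case (insert k I)
    then show ?case by (simp add: pd_add entire_add)
  qed
  have f: "entire f" "pd k f \<in> gauss_poly Q" for k using assms by (auto intro: gp_pd)
  have "first_order_op a b 0 f = (\<lambda>z. (\<Sum>k\<in>UNIV. a $ k * pd k f z) + (\<Sum>k\<in>UNIV. b $ k * z $ k) * f z)"
    by (simp add: first_order_op_def [abs_def])
  moreover have "entire (\<lambda>z. \<Sum>k\<in>UNIV. a $ k * pd k f z)"
    "pd i (\<lambda>z. \<Sum>k\<in>UNIV. a $ k * pd k f z) = (\<lambda>z. \<Sum>k\<in>UNIV. a $ k * pd k (pd i f) z)"
    using sum[of UNIV "\<lambda>k z. a $ k * pd k f z"] f gp_pd_commute[OF assms, of i]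
    by (auto simp: gp_scale pd_scale)
  ultimately show ?thesis
    using f by (simp add: pd_add entire_linear pd_linear first_order_op_def add_ac)
qed

text \<open>Second-order terms cancel because partial derivatives commute, and the mixed and
  quadratic terms are symmetric in the two operators. Only derivatives falling on a linear
  coefficient survive, and these are constants.\<close>

lemma first_order_commutator:
  assumes "transpose Q = Q" and "f \<in> gauss_poly Q"
  shows "first_order_op a b 0 (first_order_op a' b' 0 f) =
    (\<lambda>z. first_order_op a' b' 0 (first_order_op a b 0 f) z + (\<Sum>k\<in>UNIV. a $ k * b' $ k - a' $ k * b $ k) * f z)"
proof
  fix z
  have eq: "first_order_op a b 0 (first_order_op a' b' 0 f) z =
     (\<Sum>k\<in>UNIV. \<Sum>l\<in>UNIV. a $ k * (a' $ l * pd l (pd k f) z)) +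
     (\<Sum>l\<in>UNIV. b' $ l * z $ l) * (\<Sum>k\<in>UNIV. a $ k * pd k f z) +
     (\<Sum>l\<in>UNIV. b $ l * z $ l) * (\<Sum>k\<in>UNIV. a' $ k * pd k f z) +
     (\<Sum>l\<in>UNIV. b $ l * z $ l) * (\<Sum>l\<in>UNIV. b' $ l * z $ l) * f z + (\<Sum>k\<in>UNIV. a $ k * b' $ k) * f z"
    for a b a' b'
  proof -
    let ?b = "\<Sum>l\<in>UNIV. b $ l * z $ l" and ?b' = "\<Sum>l\<in>UNIV. b' $ l * z $ l"
    have "first_order_op a b 0 (first_order_op a' b' 0 f) z =
      (\<Sum>k\<in>UNIV. a $ k * ((\<Sum>l\<in>UNIV. a' $ l * pd l (pd k f) z) + ?b' * pd k f z + b' $ k * f z)) +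
      ?b * ((\<Sum>k\<in>UNIV. a' $ k * pd k f z) + ?b' * f z)"
      unfolding first_order_op_def[of a b] pd_first_order[OF assms]
      by (simp add: first_order_op_def)
    also have "(\<Sum>k\<in>UNIV. a $ k * ((\<Sum>l\<in>UNIV. a' $ l * pd l (pd k f) z) + ?b' * pd k f z + b' $ k * f z))
      = (\<Sum>k\<in>UNIV. \<Sum>l\<in>UNIV. a $ k * (a' $ l * pd l (pd k f) z)) +
        ?b' * (\<Sum>k\<in>UNIV. a $ k * pd k f z) + (\<Sum>k\<in>UNIV. a $ k * b' $ k) * f z"
      unfolding distrib_left sum.distrib sum_distrib_left[of ?b']
      by (simp add: sum_distrib_left[of "a $ _"] sum_distrib_right[of _ _ "f z"] mult.left_commute[of ?b'] mult.assoc)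
    finally show ?thesis by (simp add: algebra_simps)
  qed
  have "(\<Sum>k\<in>UNIV. \<Sum>l\<in>UNIV. a $ k * (a' $ l * pd l (pd k f) z)) =
      (\<Sum>k\<in>UNIV. \<Sum>l\<in>UNIV. a' $ k * (a $ l * pd l (pd k f) z))"
    by (subst sum.swap) (simp add: gp_pd_commute[OF assms] mult.left_commute)
  then show "first_order_op a b 0 (first_order_op a' b' 0 f) z =
    first_order_op a' b' 0 (first_order_op a b 0 f) z + (\<Sum>k\<in>UNIV. a $ k * b' $ k - a' $ k * b $ k) * f z"
    unfolding eq by (simp add: sum_subtractf algebra_simps)
qed

section \<open>Ladder operators\<close>

text \<open>The relations are demanded only on \<open>V\<close>: the operators act on arbitrary
  functions, where neither linearity nor commutation can be expected.\<close>

locale ladder =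
  fixes V :: "('b \<Rightarrow> complex) set" and L M :: "'i \<Rightarrow> ('b \<Rightarrow> complex) \<Rightarrow> 'b \<Rightarrow> complex"
    and ip :: "('b \<Rightarrow> complex) \<Rightarrow> ('b \<Rightarrow> complex) \<Rightarrow> complex" and \<kappa> :: complex and v :: "'b \<Rightarrow> complex"
  assumes vacuum: "v \<in> V" and V_scale: "f \<in> V \<Longrightarrow> (\<lambda>z. c * f z) \<in> V"
    and L_V: "f \<in> V \<Longrightarrow> L i f \<in> V" and M_V: "f \<in> V \<Longrightarrow> M i f \<in> V"
    and M_add: "f \<in> V \<Longrightarrow> g \<in> V \<Longrightarrow> M i (\<lambda>z. f z + g z) = (\<lambda>z. M i f z + M i g z)"
    and M_scale: "f \<in> V \<Longrightarrow> M i (\<lambda>z. c * f z) = (\<lambda>z. c * M i f z)"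
    and L_vacuum: "L i v = (\<lambda>z. 0)"
    and ccr: "f \<in> V \<Longrightarrow> L i (M j f) = (\<lambda>z. M j (L i f) z + (if i = j then \<kappa> else 0) * f z)"
    and M_commute: "f \<in> V \<Longrightarrow> M i (M j f) = M j (M i f)"
    and \<kappa>_real: "cnj \<kappa> = \<kappa>" and ip_cnj: "ip g f = cnj (ip f g)" and ip_scale: "ip (\<lambda>z. c * f z) g = c * ip f g"
    and adj: "f \<in> V \<Longrightarrow> g \<in> V \<Longrightarrow> ip (L i f) g = ip f (M i g)"
begin

text \<open>The list of indices is a parameter so that the product of powers can be treated by
  induction on it; exponents outside the list have no influence.\<close>

definition state :: "'i list \<Rightarrow> ('i \<Rightarrow> nat) \<Rightarrow> 'b \<Rightarrow> complex" where
  "state xs a = foldr (\<lambda>i. M i ^^ a i) xs v"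

lemma Mpow_V: "f \<in> V \<Longrightarrow> (M i ^^ n) f \<in> V"
  by (induction n) (auto intro: M_V)

lemma state_V: "state xs a \<in> V"
  by (induction xs) (auto simp: state_def intro: vacuum Mpow_V)

lemma Mpow_scale: "f \<in> V \<Longrightarrow> (M i ^^ n) (\<lambda>z. c * f z) = (\<lambda>z. c * (M i ^^ n) f z)"
  by (induction n) (auto simp: M_scale Mpow_V)

lemma Mpow_zero: "(M i ^^ n) (\<lambda>z. 0) = (\<lambda>z. 0)"
  using Mpow_scale[OF vacuum, of n i 0] by simp

lemma Mpow_commute: "f \<in> V \<Longrightarrow> M i ((M j ^^ n) f) = (M j ^^ n) (M i f)"
proof (induction n)
  case (Suc n)
  then show ?case using M_commute[OF Mpow_V[OF Suc.prems], of i j n j] by simp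
qed simp

lemma L_Mpow:
  assumes "f \<in> V"
  shows "L i ((M j ^^ n) f) =
    (\<lambda>z. (M j ^^ n) (L i f) z + (if i = j then \<kappa> * of_nat n * (M j ^^ (n - 1)) f z else 0))"
proof (induction n)
  case (Suc n)
  have V: "(M j ^^ n) f \<in> V" "(M j ^^ n) (L i f) \<in> V" "(M j ^^ (n - 1)) f \<in> V"
    using assms by (auto intro: Mpow_V L_V)
  have "L i ((M j ^^ Suc n) f) =
      (\<lambda>z. M j (L i ((M j ^^ n) f)) z + (if i = j then \<kappa> else 0) * (M j ^^ n) f z)"
    using ccr[OF V(1)] by simp
  also have "M j (L i ((M j ^^ n) f)) = (\<lambda>z. M j ((M j ^^ n) (L i f)) z
      + M j (\<lambda>z. (if i = j then \<kappa> * of_nat n else 0) * (M j ^^ (n - 1)) f z) z)"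
    unfolding Suc.IH by (subst M_add [OF V(2) V_scale[OF V(3)], symmetric]) (simp add: if_distribR cong: if_cong)
  also have "M j (\<lambda>z. (if i = j then \<kappa> * of_nat n else 0) * (M j ^^ (n - 1)) f z)
      = (\<lambda>z. (if i = j then \<kappa> * of_nat n else 0) * (M j ^^ n) f z)"
    \<comment> \<open>For \<open>n = 0\<close> the coefficient vanishes, so the truncated
      \<open>n - 1\<close> is harmless; otherwise one application of \<open>M j\<close> restores the
      power \<open>n\<close>.\<close>
    using M_scale[OF V(3)] by (cases n) auto
  finally show ?case by (auto simp: fun_eq_iff algebra_simps)
qed (auto simp: fun_eq_iff)

lemma state_cong: "(\<And>i. i \<in> set xs \<Longrightarrow> a i = b i) \<Longrightarrow> state xs a = state xs b"
  by (induction xs) (auto simp: state_def)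

lemma state_Cons: "state (j # xs) a = (M j ^^ a j) (state xs a)"
  by (simp add: state_def)

text \<open>\<open>L i\<close> passes every power except that of \<open>M i\<close> and finally
  annihilates the vacuum. Distinctness leaves a single such power, and for \<open>a i = 0\<close>
  the factor in front covers the truncated subtraction.\<close>

lemma L_state:
  assumes "distinct xs"
  shows "L i (state xs a) =
    (\<lambda>z. (if i \<in> set xs then \<kappa> * of_nat (a i) else 0) * state xs (a(i := a i - 1)) z)"
  using assms
proof (induction xs)
  case Nil
  then show ?case by (simp add: state_def L_vacuum)
next
  case (Cons j xs)
  show ?case
  proof (cases "i = j")
    case True
    then have "state xs (a(i := a i - 1)) = state xs a"
      using Cons.prems by (intro state_cong) auto
    then show ?thesis
      using True Cons by (simp add: state_Cons L_Mpow[OF state_V] Mpow_zero del: fun_upd_apply)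
        (simp add: fun_upd_same)
  next
    case False
    then show ?thesis
      using Cons by (simp add: state_Cons L_Mpow[OF state_V] Mpow_scale[OF state_V])
  qed
qed

lemma M_state:
  assumes "distinct xs" and "i \<in> set xs"
  shows "M i (state xs a) = state xs (a(i := a i + 1))"
  using assms
proof (induction xs)
  case (Cons j xs)
  show ?case
  proof (cases "i = j")
    case True
    then have "state xs (a(i := a i + 1)) = state xs a"
      using Cons.prems by (intro state_cong) auto
    then show ?thesis using True by (simp add: state_Cons fun_upd_same del: fun_upd_apply)
  next
    case False
    then show ?thesis using Cons by (simp add: state_Cons Mpow_commute[OF state_V])
  qed
qed simp

lemma number_state:
  assumes "distinct xs" and "i \<in> set xs"
  shows "M i (L i (state xs a)) = (\<lambda>z. \<kappa> * of_nat (a i) * state xs a z)"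
proof (cases "a i")
  case 0
  then show ?thesis using assms Mpow_zero[of 1 i] by (simp add: L_state)
next
  case (Suc n)
  then have "a(i := n, i := n + 1) = a" by auto
  then show ?thesis
    using assms Suc M_state[OF assms, of "a(i := n)"] by (simp add: L_state M_scale[OF state_V])
qed

text \<open>Induction on the degree of the left state: one \<open>M i\<close> is peeled off it and
  moved as \<open>L i\<close> onto the right state, lowering both. In degree 0 a remaining
  \<open>M i\<close> on the right is moved onto the vacuum, which it annihilates as
  \<open>L i\<close>.\<close>

lemma ip_state:
  assumes "distinct xs"
  shows "ip (state xs a) (state xs b) = (if \<forall>i\<in>set xs. a i = b i
    then \<kappa> ^ (\<Sum>i\<in>set xs. a i) * of_nat (\<Prod>i\<in>set xs. fact (a i)) * ip v v else 0)"
proof (induction "\<Sum>i\<in>set xs. a i" arbitrary: a b)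
  case 0
  then have a: "\<And>i. i \<in> set xs \<Longrightarrow> a i = 0" by simp
  then have sa: "state xs a = v" by (induction xs) (auto simp: state_def)
  show ?case
  proof (cases "\<forall>i\<in>set xs. a i = b i")
    case True
    then have "state xs b = v" using sa state_cong[of xs a b] by simp
    then show ?thesis using True a sa by simp
  next
    case False
    then obtain i where i: "i \<in> set xs" "b i \<noteq> 0" using a by auto
    then have "state xs b = M i (state xs (b(i := b i - 1)))"
      using assms by (simp add: M_state)
    then have "ip (state xs a) (state xs b) = ip (L i v) (state xs (b(i := b i - 1)))"
      by (simp add: sa adj[OF vacuum state_V])
    also have "\<dots> = 0" using ip_scale[of 0 v] by (simp add: L_vacuum)
    finally show ?thesis unfolding if_not_P[OF False] .
  qed
next
  case (Suc m)
  then obtain i where i: "i \<in> set xs" "a i \<noteq> 0"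
    by (metis Zero_not_Suc sum.neutral)
  define a' where "a' = a(i := a i - 1)"
  define b' where "b' = b(i := b i - 1)"
  have "(\<Sum>k\<in>set xs. a k) = Suc (\<Sum>k\<in>set xs. a' k)"
    using i by (simp add: a'_def sum.remove[of _ i])
  then have IH: "m = (\<Sum>k\<in>set xs. a' k)" using Suc.hyps(2) by simp
  have "state xs a = M i (state xs a')" using i assms by (simp add: M_state a'_def)
  then have "ip (state xs a) (state xs b) = cnj (ip (L i (state xs b)) (state xs a'))"
    by (metis ip_cnj adj state_V)
  also have "\<dots> = cnj \<kappa> * of_nat (b i) * ip (state xs a') (state xs b')"
    using i ip_cnj[of "state xs a'" "state xs b'"] by (simp add: L_state[OF assms] ip_scale b'_def)
  finally have 1: "ip (state xs a) (state xs b) = cnj \<kappa> * of_nat (b i) * ip (state xs a') (state xs b')" .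
  show ?case
  proof (cases "\<forall>k\<in>set xs. a k = b k")
    case True
    then have "\<forall>k\<in>set xs. a' k = b' k" "b i = a i" using i by (auto simp: a'_def b'_def)
    moreover have "of_nat (a i) * (of_nat (\<Prod>k\<in>set xs. fact (a' k)) :: complex)
        = of_nat (\<Prod>k\<in>set xs. fact (a k))"
      using i by (cases "a i") (simp_all add: a'_def prod.remove[of _ i] algebra_simps)
    ultimately show ?thesis
      unfolding 1 Suc.hyps(1)[OF IH, of b'] Suc.hyps(2) [symmetric] using True IH
      by (simp add: \<kappa>_real mult_ac)
  next
    case False
    \<comment> \<open>Lowering can hide a difference only at \<open>b i = 0\<close>, by truncated
      subtraction; there the factor \<open>b i\<close> already gives 0.\<close>
    then have "b i = 0 \<or> \<not> (\<forall>k\<in>set xs. a' k = b' k)"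
      using i by (force simp: a'_def b'_def split: if_splits)
    then have "ip (state xs a) (state xs b) = 0" using 1 Suc.hyps(1)[OF IH, of b'] by auto
    then show ?thesis unfolding if_not_P[OF False] .
  qed
qed

end

section \<open>The adjoint operators\<close>

lemma first_order_diff:
  "first_order_op a b c f z - first_order_op a' b' c' f z = first_order_op (a - a') (b - b') (c - c') f z"
  by (simp add: first_order_op_def sum_subtractf algebra_simps)

lemma first_order_add:
  assumes "entire f" and "entire g"
  shows "first_order_op a b c (\<lambda>z. f z + g z) = (\<lambda>z. first_order_op a b c f z + first_order_op a b c g z)"
  by (simp add: first_order_op_def fun_eq_iff pd_add[OF assms] sum.distrib algebra_simps)

lemma first_order_scale:
  assumes "entire f"
  shows "first_order_op a b c (\<lambda>z. d * f z) = (\<lambda>z. d * first_order_op a b c f z)"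
  by (simp add: first_order_op_def fun_eq_iff pd_scale[OF assms] sum_distrib_left algebra_simps)

lemma Lambda_psi0: "transpose Q = Q \<Longrightarrow> Lambda Q i (psi0 Q) = (\<lambda>z. 0)"
  by (simp add: Lambda_def fun_eq_iff pd_psi0 matrix_vector_mult_def)

text \<open>Testing on the vacuum and on its products with the coordinates recovers all coefficients.\<close>

lemma first_order_eq_0:
  assumes "transpose Q = Q" and zero: "\<And>f. f \<in> gauss_poly Q \<Longrightarrow> first_order_op a b c f = (\<lambda>z. 0)"
  shows "a = 0" and "b = 0" and "c = 0"
proof -
  have nz: "psi0 Q z \<noteq> 0" for z by (simp add: psi0_def)
  have "a $ j = 0" for j
  proof -
    have "first_order_op a b c (\<lambda>z. z $ j * psi0 Q z) z =
        z $ j * first_order_op a b c (psi0 Q) z + a $ j * psi0 Q z" for z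
    proof -
      have "(\<Sum>k\<in>UNIV. a $ k * pd k (\<lambda>z. z $ j * psi0 Q z) z) =
          a $ j * psi0 Q z + z $ j * (\<Sum>k\<in>UNIV. a $ k * pd k (psi0 Q) z)"
        unfolding pd_coord[OF entire_psi0[OF assms(1)]] distrib_left sum.distrib
        by (simp add: sum_distrib_left if_distrib[of "(*) _"] mult.left_commute cong: if_cong)
      then show ?thesis by (simp add: first_order_op_def algebra_simps)
    qed
    then show ?thesis using zero[OF gp_psi0] zero[OF gp_coord[OF gp_psi0]] nz by (simp add: fun_eq_iff)
  qed
  then show a: "a = 0" by (simp add: vec_eq_iff)
  have lin: "(\<Sum>k\<in>UNIV. b $ k * z $ k) + c = 0" for z
    using fun_cong[OF zero[OF gp_psi0], of z] nz[of z]
    by (simp add: first_order_op_def a flip: distrib_right)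
  from lin[of 0] show c: "c = 0" by simp
  have "b $ j = 0" for j
    using lin[of "axis j 1"] c by (simp add: axis_def if_distrib cong: if_cong)
  then show "b = 0" by (simp add: vec_eq_iff)
qed

text \<open>The right side of \<open>coercive\<close> is
  \<open>wt z + Re (bilin z (Q *v z))\<close>, so the squared vacuum times
  \<open>exp (- 2 * wt z)\<close> is at most \<open>exp (- 2 * c * (norm z)\<^sup>2)\<close>. The
  parameter \<open>r\<close> will be \<open>\<rho>\<^sup>2\<close>.\<close>

locale oscillator = quadratic_weight P S for P S :: "complex^'n^'n" +
  fixes Q T :: "complex^'n^'n" and r c :: real
  assumes Q_sym: "transpose Q = Q"
    and T_P: "T ** P = cnj_mat (Q + S)"
    and T_ccr: "(Q + S) ** transpose T = P - mat (complex_of_real r)"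
    and c_pos: "0 < c"
    and coercive: "\<And>z. c * (norm z)\<^sup>2 \<le> Re (bilin z (P *v cnj_vec z)) + Re (bilin z ((Q + S) *v z))"
begin

text \<open>A growth rate \<open>c / 2\<close> costs \<open>c\<close> after squaring, half of the
  available decay \<open>2 * c\<close>; the other half remains as an integrable Gaussian.\<close>

lemma gp_H_space:
  assumes "f \<in> gauss_poly Q"
  shows "f \<in> H_space wt"
proof -
  obtain K where K: "\<And>z. cmod (f z) \<le> K * exp (c / 2 * (norm z)\<^sup>2) * cmod (psi0 Q z)"
    using gp_growth[OF assms, of "c / 2"] c_pos by auto
  have e: "entire f" using gp_entire[OF Q_sym assms] .
  have bound: "(cmod (f z))\<^sup>2 * exp (- 2 * wt z) \<le> K\<^sup>2 * exp (- c * (norm z)\<^sup>2)" for z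
  proof -
    have "(cmod (f z))\<^sup>2 \<le> (K * exp (c / 2 * (norm z)\<^sup>2) * cmod (psi0 Q z))\<^sup>2"
      using K by (intro power_mono) auto
    also have "\<dots> = K\<^sup>2 * exp (c * (norm z)\<^sup>2 - 2 * Re (bilin z (Q *v z)))"
    proof -
      have "(cmod (psi0 Q z))\<^sup>2 = exp (- 2 * Re (bilin z (Q *v z)))"
        by (simp add: psi0_def norm_exp_eq_Re flip: exp_double)
      moreover have "(exp (c / 2 * (norm z)\<^sup>2))\<^sup>2 = exp (c * (norm z)\<^sup>2)"
        by (simp flip: exp_double)
      ultimately show ?thesis by (simp add: power_mult_distrib exp_diff exp_minus field_simps)
    qed
    finally have "(cmod (f z))\<^sup>2 * exp (- 2 * wt z) \<le>
        (K\<^sup>2 * exp (c * (norm z)\<^sup>2 - 2 * Re (bilin z (Q *v z)))) * exp (- 2 * wt z)"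
      by (rule mult_right_mono) simp
    also have "\<dots> = K\<^sup>2 * exp (c * (norm z)\<^sup>2 - 2 * Re (bilin z (Q *v z)) - 2 * wt z)"
      by (simp flip: exp_add)
    also have "\<dots> \<le> K\<^sup>2 * exp (- c * (norm z)\<^sup>2)"
    proof (rule mult_left_mono)
      have "bilin z ((Q + S) *v z) = bilin z (Q *v z) + bilin z (S *v z)"
        by (simp add: matrix_vector_mult_add_rdistrib bilin_def distrib_left sum.distrib)
      then show "exp (c * (norm z)\<^sup>2 - 2 * Re (bilin z (Q *v z)) - 2 * wt z) \<le> exp (- c * (norm z)\<^sup>2)"
        using coercive[of z] by (simp add: wt_def)
    qed simp
    finally show ?thesis .
  qed
  have "integrable lborel (\<lambda>z. (cmod (f z))\<^sup>2 * exp (- 2 * wt z))"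
  proof (rule Bochner_Integration.integrable_bound)
    show "integrable lborel (\<lambda>z::complex^'n. K\<^sup>2 * exp (- c * (norm z)\<^sup>2))"
      using integrable_gaussian[OF c_pos] by (rule integrable_mult_right)
    show "(\<lambda>z. (cmod (f z))\<^sup>2 * exp (- 2 * wt z)) \<in> borel_measurable lborel"
      by (simp, intro borel_measurable_continuous_onI continuous_intros entire_continuous e weight_continuous)
  qed (use bound in auto)
  with e show ?thesis by (simp add: H_space_def)
qed

lemma gp_adjoint_domain: "f \<in> gauss_poly Q \<Longrightarrow> f \<in> adjoint_domain wt"
  by (simp add: adjoint_domain_def gp_H_space gp_coord gp_pd[OF Q_sym])

text \<open>This is \<open>2 conj P z + T D\<close> with \<open>D = \<partial> - 2 S z\<close>
  expanded into coefficients.\<close>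

definition star :: "'n \<Rightarrow> 'n operator" where
  "star i = first_order_op (T $ i) (\<chi> k. 2 * cnj (P $ i $ k) - 2 * (T ** S) $ i $ k) 0"

text \<open>With \<open>a\<close> and \<open>b\<close> collecting the products of \<open>F\<close>
  and \<open>G\<close> with one coordinate factor, both sides reduce to
  \<open>2 P b + 2 (Q + S) a\<close>. The \<open>T ** S\<close> term in \<open>star\<close> cancels
  what \<open>H_inner_pd\<close> contributes through \<open>S\<close>, and \<open>T_P\<close>
  handles the rest.\<close>

lemma star_adjoint: "is_adjoint_op wt (Lambda Q i) (star i)"
  unfolding is_adjoint_op_def
proof (intro conjI ballI)
  show "\<exists>a b c. star i = first_order_op a b c" by (auto simp: star_def)
  fix F G assume F: "F \<in> adjoint_domain wt" and G: "G \<in> adjoint_domain wt"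
  then have H: "F \<in> H_space wt" "G \<in> H_space wt" by (auto simp: adjoint_domain_def)
  define a where "a = (\<chi> k. H_inner wt (\<lambda>z. z $ k * F z) G)"
  define b where "b = (\<chi> k. H_inner wt F (\<lambda>z. z $ k * G z))"
  have R: "cnj_mat (Q + S) *v cnj_vec v = cnj_vec ((Q + S) *v v)" for v
    by (simp add: cnj_mat_def cnj_vec_def map_matrix_def matrix_vector_mult_def vec_eq_iff)
  have 1: "H_inner wt (Lambda Q i F) G = 2 * (P *v b) $ i + 2 * ((Q + S) *v a) $ i"
    unfolding Lambda_first_order H_inner_first_order[OF F H(2)] H_inner_pd[OF F G]
    by (simp add: axis_def if_distrib if_distribR matrix_vector_mult_def a_def b_def sum.distrib
        sum_distrib_left algebra_simps cong: if_cong)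
  have "H_inner wt (star i G) F = 2 * (T *v (P *v cnj_vec a)) $ i + 2 * (\<Sum>k\<in>UNIV. cnj (P $ i $ k) * cnj_vec b $ k)"
  proof -
    have p: "H_inner wt (pd k G) F = 2 * (P *v cnj_vec a) $ k + 2 * (S *v cnj_vec b) $ k" for k
      unfolding H_inner_pd[OF G F] by (simp add: matrix_vector_mult_def cnj_vec_def a_def b_def flip: H_inner_cnj)
    have q: "H_inner wt (\<lambda>z. z $ k * G z) F = cnj_vec b $ k" for k
      by (simp add: cnj_vec_def b_def flip: H_inner_cnj)
    have "(\<Sum>k\<in>UNIV. (T ** S) $ i $ k * cnj_vec b $ k) = (T *v (S *v cnj_vec b)) $ i"
      unfolding matrix_vector_mul_assoc by (simp add: matrix_vector_mult_def)
    moreover have "(\<Sum>k\<in>UNIV. T $ i $ k * (2 * x $ k + 2 * y $ k)) = 2 * (T *v x) $ i + 2 * (T *v y) $ i" for x y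
      by (simp add: matrix_vector_mult_def distrib_left sum.distrib sum_distrib_left mult.left_commute)
    moreover have "(\<Sum>k\<in>UNIV. (2 * cnj (P $ i $ k) - 2 * M $ i $ k) * x $ k) =
        2 * (\<Sum>k\<in>UNIV. cnj (P $ i $ k) * x $ k) - 2 * (\<Sum>k\<in>UNIV. M $ i $ k * x $ k)" for M :: "complex^'n^'n" and x
      by (simp add: left_diff_distrib sum_subtractf sum_distrib_left mult.assoc)
    ultimately show ?thesis
      unfolding star_def H_inner_first_order[OF G H(1)] p q by simp
  qed
  also have "T *v (P *v cnj_vec a) = cnj_vec ((Q + S) *v a)"
    by (simp add: matrix_vector_mul_assoc T_P R)
  finally have "cnj (H_inner wt (star i G) F) = 2 * ((Q + S) *v a) $ i + 2 * (P *v b) $ i"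
    by (simp add: cnj_vec_def matrix_vector_mult_def[of P])
  then show "H_inner wt (Lambda Q i F) G = H_inner wt F (star i G)"
    using 1 H_inner_cnj[of wt F "star i G"] by simp
qed

text \<open>The integral forces \<open>f = 0\<close> almost everywhere; by continuity the set where
  \<open>f\<close> is nonzero is open, and a nonempty open set is not negligible.\<close>

lemma H_inner_definite:
  assumes "f \<in> H_space wt" and "H_inner wt f f = 0"
  shows "f = (\<lambda>z. 0)"
proof -
  let ?g = "\<lambda>z. (cmod (f z))\<^sup>2 * exp (- 2 * wt z)"
  have "(\<integral>z. ?g z \<partial>lborel) = 0" using assms(2) by (simp add: H_inner_self_integral)
  then have "AE z in lborel. ?g z = 0"
    using assms(1) by (subst (asm) integral_nonneg_eq_0_iff_AE) (auto simp: H_space_def)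
  then have "AE z in lborel. f z = 0" by simp
  moreover have op: "open {z. f z \<noteq> 0}"
    using open_vimage[OF open_Compl[OF closed_singleton] entire_continuous[of f], of 0]
    assms(1)
    by (simp add: vimage_def Compl_eq H_space_def)
  ultimately have "{z. f z \<noteq> 0} \<in> null_sets lborel"
    using AE_iff_null_sets[of "{z. f z \<noteq> 0}" lborel] by simp
  then have "negligible {z. f z \<noteq> 0}"
    by (simp add: negligible_iff_null_sets null_sets_completionI)
  with op have "{z. f z \<noteq> 0} = {}" by (meson open_not_negligible)
  then show ?thesis by auto
qed

lemma Lambda_star_eq: "Lambda_star wt Q i = star i"
  unfolding Lambda_star_def adjoint_op_def
proof (rule the_equality)
  show "is_adjoint_op wt (Lambda Q i) (star i)" by (rule star_adjoint)
  fix M assume M: "is_adjoint_op wt (Lambda Q i) M"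
  then obtain a b c where Mdef: "M = first_order_op a b c" by (auto simp: is_adjoint_op_def)
  obtain a' b' c' where sdef: "star i = first_order_op a' b' c'" by (auto simp: star_def)
  have "first_order_op (a - a') (b - b') (c - c') f = (\<lambda>z. 0)" if f: "f \<in> gauss_poly Q" for f
  proof (rule H_inner_definite)
    let ?d = "first_order_op (a - a') (b - b') (c - c') f"
    have gp: "?d \<in> gauss_poly Q" "M f \<in> gauss_poly Q" "star i f \<in> gauss_poly Q"
      using f gp_first_order[OF Q_sym] by (auto simp: Mdef sdef)
    then show "?d \<in> H_space wt" using gp_H_space by auto
    \<comment> \<open>Both sides equal the inner product of \<open>Lambda Q i ?d\<close> with
      \<open>f\<close>; here \<open>?d\<close> is itself used as the test function.\<close>
    have "H_inner wt ?d (M f) = H_inner wt ?d (star i f)"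
      using M star_adjoint gp_adjoint_domain[OF gp(1)] gp_adjoint_domain[OF f]
      unfolding is_adjoint_op_def by metis
    then have "H_inner wt (M f) ?d = H_inner wt (star i f) ?d"
      by (metis H_inner_cnj)
    moreover have "M f = (\<lambda>z. ?d z + star i f z)"
      by (simp add: Mdef sdef fun_eq_iff flip: first_order_diff)
    ultimately show "H_inner wt ?d ?d = 0"
      using H_inner_add[of ?d "star i f" ?d] gp gp_H_space by simp
  qed
  from first_order_eq_0[OF Q_sym this] show "M = star i" by (simp add: Mdef sdef)
qed

text \<open>The commutator scalar is antisymmetrized from \<open>T P\<close> and
  \<open>T S T\<^sup>t\<close>. Both are symmetric: the first is the conjugate of
  \<open>Q + S\<close>, the second inherits symmetry from \<open>S\<close>.\<close>

lemma star_commute: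
  assumes "f \<in> gauss_poly Q"
  shows "star i (star j f) = star j (star i f)"
proof -
  have TP: "(\<Sum>k\<in>UNIV. T $ i $ k * cnj (P $ j $ k)) = cnj ((Q + S) $ i $ j)" for i j
    using arg_cong[OF T_P, of "\<lambda>M. M $ i $ j"]
    by (simp add: matrix_matrix_mult_def P_cnj cnj_mat_def map_matrix_def)
  have TS: "(\<Sum>k\<in>UNIV. T $ i $ k * (T ** S) $ j $ k) = (\<Sum>k\<in>UNIV. T $ j $ k * (T ** S) $ i $ k)"
  proof -
    have S: "S $ k $ l = S $ l $ k" for k l
      using arg_cong[OF S_sym, of "\<lambda>M. M $ l $ k"] by (simp add: transpose_def)
    show ?thesis
      unfolding matrix_matrix_mult_def vec_lambda_beta sum_distrib_left
      by (subst sum.swap) (simp add: mult_ac S)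
  qed
  have sym: "Q $ i $ j = Q $ j $ i" "S $ i $ j = S $ j $ i"
    using arg_cong[OF Q_sym, of "\<lambda>M. M $ j $ i"] arg_cong[OF S_sym, of "\<lambda>M. M $ j $ i"]
    by (simp_all add: transpose_def)
  show ?thesis
    unfolding star_def first_order_commutator[OF Q_sym assms, of "T $ i"]
    using TP[of i j] TP[of j i] TS sym
    by (simp add: right_diff_distrib sum_subtractf mult.left_commute[of _ 2] flip: sum_distrib_left)
qed

lemma Lambda_star_ccr:
  assumes "f \<in> gauss_poly Q"
  shows "Lambda Q i (star j f) =
    (\<lambda>z. star j (Lambda Q i f) z + (if i = j then complex_of_real (2 * r) else 0) * f z)"
proof -
  have sym: "Q $ i $ k = Q $ k $ i" "S $ i $ k = S $ k $ i" for i k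
    using arg_cong[OF Q_sym, of "\<lambda>M. M $ k $ i"] arg_cong[OF S_sym, of "\<lambda>M. M $ k $ i"]
    by (simp_all add: transpose_def)
  have 1: "P $ i $ j = (\<Sum>k\<in>UNIV. Q $ i $ k * T $ j $ k) + (\<Sum>k\<in>UNIV. S $ i $ k * T $ j $ k)
      + (if i = j then complex_of_real r else 0)"
    using arg_cong[OF T_ccr, of "\<lambda>M. M $ i $ j"]
    by (simp add: matrix_matrix_mult_def transpose_def mat_def distrib_right sum.distrib)
  have 2: "(T ** S) $ j $ i = (\<Sum>k\<in>UNIV. S $ i $ k * T $ j $ k)"
    by (simp add: matrix_matrix_mult_def sym(2)[of i] mult.commute)
  have "(\<Sum>k\<in>UNIV. axis i 1 $ k * (2 * cnj (P $ j $ k) - 2 * (T ** S) $ j $ k)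
      - T $ j $ k * (2 * Q $ i $ k)) = (if i = j then complex_of_real (2 * r) else 0)"
  proof -
    have "(\<Sum>k\<in>UNIV. axis i 1 $ k * x k) = x i" for x :: "'n \<Rightarrow> complex"
      by (simp add: axis_def if_distrib if_distribR cong: if_cong)
    note 3 = this
    have 4: "(\<Sum>k\<in>UNIV. T $ j $ k * (2 * Q $ i $ k)) = 2 * (\<Sum>k\<in>UNIV. Q $ i $ k * T $ j $ k)"
      by (simp add: sum_distrib_left mult_ac)
    show ?thesis
      by (simp only: sum_subtractf 3 4) (simp add: P_cnj 1 2 algebra_simps)
  qed
  then show ?thesis
    unfolding star_def Lambda_first_order first_order_commutator[OF Q_sym assms, of "axis i 1"] by simp
qed

sublocale ladder "gauss_poly Q" "Lambda Q" "Lambda_star wt Q" "H_inner wt" "complex_of_real (2 * r)" "psi0 Q"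
proof
  fix f g i j d
  assume f: "f \<in> gauss_poly Q"
  show "(\<lambda>z. d * f z) \<in> gauss_poly Q" using f by (rule gp_scale)
  show "Lambda Q i f \<in> gauss_poly Q" unfolding Lambda_first_order using f by (rule gp_first_order[OF Q_sym])
  show "Lambda_star wt Q i f \<in> gauss_poly Q"
    unfolding Lambda_star_eq star_def using f by (rule gp_first_order[OF Q_sym])
  show "Lambda_star wt Q i (\<lambda>z. d * f z) = (\<lambda>z. d * Lambda_star wt Q i f z)"
    unfolding Lambda_star_eq star_def using gp_entire[OF Q_sym f] by (rule first_order_scale)
  show "Lambda Q i (Lambda_star wt Q j f) =
      (\<lambda>z. Lambda_star wt Q j (Lambda Q i f) z + (if i = j then complex_of_real (2 * r) else 0) * f z)"
    unfolding Lambda_star_eq using f by (rule Lambda_star_ccr)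
  show "Lambda_star wt Q i (Lambda_star wt Q j f) = Lambda_star wt Q j (Lambda_star wt Q i f)"
    unfolding Lambda_star_eq using f by (rule star_commute)
  assume g: "g \<in> gauss_poly Q"
  show "Lambda_star wt Q i (\<lambda>z. f z + g z) = (\<lambda>z. Lambda_star wt Q i f z + Lambda_star wt Q i g z)"
    unfolding Lambda_star_eq star_def using gp_entire[OF Q_sym f] gp_entire[OF Q_sym g] by (rule first_order_add)
  show "H_inner wt (Lambda Q i f) g = H_inner wt f (Lambda_star wt Q i g)"
    unfolding Lambda_star_eq using star_adjoint gp_adjoint_domain[OF f] gp_adjoint_domain[OF g]
    unfolding is_adjoint_op_def by blast
qed (simp_all add: gp_psi0 Lambda_psi0 Q_sym H_inner_cnj[symmetric] H_inner_scale)

end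

section \<open>The quadratic weight of the theorem\<close>

lemma cnj_mat_nth: "cnj_mat M $ i $ j = cnj (M $ i $ j)"
  by (simp add: cnj_mat_def map_matrix_def)

lemma cnj_mat_mult: "cnj_mat (M ** N) = cnj_mat M ** cnj_mat N"
  by (simp add: vec_eq_iff cnj_mat_nth matrix_matrix_mult_def)

lemma cnj_mat_transpose: "cnj_mat (transpose M) = transpose (cnj_mat M)"
  by (simp add: vec_eq_iff cnj_mat_nth transpose_def)

lemma cnj_mat_cnj_mat: "cnj_mat (cnj_mat M) = M"
  by (simp add: vec_eq_iff cnj_mat_nth)

lemma cnj_mat_diag: "cnj_mat (diag_mat d) = diag_mat d"
  by (simp add: vec_eq_iff cnj_mat_nth diag_mat_def)

lemma transpose_diag: "transpose (diag_mat d) = diag_mat d"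
  by (simp add: vec_eq_iff transpose_def diag_mat_def)

lemma diag_mult: "diag_mat d ** diag_mat e = diag_mat (\<lambda>i. d i * e i)"
proof -
  have "(\<Sum>k\<in>UNIV. diag_mat d $ i $ k * M $ k $ j) = complex_of_real (d i) * M $ i $ j"
    for M :: "complex^'a^'a" and i j
    by (simp add: diag_mat_def if_distrib[of "\<lambda>x. x * _"] cong: if_cong)
  then show ?thesis
    unfolding matrix_matrix_mult_def by (simp add: vec_eq_iff) (simp add: diag_mat_def)
qed

lemma diag_mult_assoc: "M ** diag_mat d ** diag_mat e = M ** diag_mat (\<lambda>i. d i * e i)"
  by (simp add: diag_mult flip: matrix_mul_assoc)

lemma diag_mv: "(diag_mat d *v z) $ i = complex_of_real (d i) * z $ i"
  by (simp add: matrix_vector_mult_def diag_mat_def if_distrib if_distribR cong: if_cong)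

lemma bilin_mv_left: "bilin z ((M ** N) *v w) = bilin (transpose M *v z) (N *v w)"
  using bilin_transpose[of z M "N *v w"]
  by (simp add: bilin_def mult.commute flip: matrix_vector_mul_assoc)

lemma cnj_vec_mv: "cnj_vec (M *v z) = cnj_mat M *v cnj_vec z"
  by (simp add: vec_eq_iff cnj_vec_def cnj_mat_nth matrix_vector_mult_def)

lemma norm_sum_squares: "(norm (z :: complex^'n))\<^sup>2 = (\<Sum>i\<in>UNIV. (cmod (z $ i))\<^sup>2)"
  by (simp add: norm_vec_def L2_set_def sum_nonneg)

lemma norm_eq_bilin: "complex_of_real ((norm z)\<^sup>2) = bilin z (cnj_vec z)"
  unfolding norm_sum_squares of_real_sum complex_norm_square by (simp add: bilin_def cnj_vec_def)

text \<open>The hypothesis is the conjugate of the usual isometry condition, in the form that the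
  bilinear pairing produces.\<close>

lemma norm_isometry:
  assumes "transpose M ** cnj_mat M = mat 1"
  shows "norm (M *v z) = norm z"
proof -
  have "complex_of_real ((norm (M *v z))\<^sup>2) = bilin (M *v z) (cnj_mat M *v cnj_vec z)"
    by (simp only: norm_eq_bilin cnj_vec_mv)
  also have "\<dots> = bilin z (cnj_vec z)"
    using bilin_mv_left[of z "transpose M" "cnj_mat M" "cnj_vec z"] assms by simp
  finally have "(norm (M *v z))\<^sup>2 = (norm z)\<^sup>2"
    by (simp only: norm_eq_bilin [symmetric] of_real_eq_iff)
  then show ?thesis by simp
qed

lemma transpose_scale_mat: "transpose (scale_mat c M) = scale_mat c (transpose M)"
  by (simp add: vec_eq_iff transpose_def scale_mat_def map_matrix_def)

lemma transpose_minus: "transpose (M - N) = transpose M - transpose N"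
  by (simp add: vec_eq_iff transpose_def)

lemma transpose_uminus: "transpose (- M) = - transpose M"
  by (simp add: vec_eq_iff transpose_def)

text \<open>\<open>matrix_inv\<close> is a choice; a one-sided inverse of a square matrix is
  two-sided, so the chosen matrix is a true inverse and transposing its equation identifies
  it.\<close>

lemma matrix_inv_symmetric:
  fixes M :: "complex^'n^'n"
  assumes "transpose M = M" and "M ** N = mat 1"
  shows "transpose (matrix_inv M) = matrix_inv M"
proof -
  have NM: "N ** M = mat 1" using assms(2) by (simp add: matrix_left_right_inverse)
  then have "\<exists>N. M ** N = mat 1 \<and> N ** M = mat 1" using assms(2) by blast
  then have I: "M ** matrix_inv M = mat 1 \<and> matrix_inv M ** M = mat 1"
    unfolding matrix_inv_def by (rule someI_ex)
  have "transpose (matrix_inv M) ** M = mat 1"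
    using arg_cong[OF conjunct1[OF I], of transpose] assms(1) by (simp add: matrix_transpose_mul)
  then have "transpose (matrix_inv M) ** M ** matrix_inv M = matrix_inv M" by simp
  then show ?thesis using I by (simp flip: matrix_mul_assoc)
qed

lemma Phi_zz_symmetric:
  assumes "transpose A = A" and "transpose C = C" and "pos_def_mat (imag_mat C)"
  shows "transpose (Phi_zz A B C) = Phi_zz A B C"
proof -
  have C: "transpose (imag_mat C) = imag_mat C"
    using assms(2) by (simp add: imag_mat_def transpose_scale_mat transpose_minus flip: cnj_mat_transpose)
  \<comment> \<open>Positive definiteness gives a trivial kernel, hence invertibility, which makes
    the inverse in \<open>Phi_zz\<close> symmetric.\<close>
  have "z = 0" if "imag_mat C *v z = 0" for z
    using assms(3) that by (force simp: pos_def_mat_def bilin_def)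
  then obtain N where "N ** imag_mat C = mat 1"
    using matrix_left_invertible_ker[of "imag_mat C"] by blast
  then have "imag_mat C ** N = mat 1" by (simp add: matrix_left_right_inverse)
  from matrix_inv_symmetric[OF C this] assms(1) show ?thesis
    by (simp add: Phi_zz_def transpose_minus transpose_uminus transpose_scale_mat matrix_transpose_mul
        matrix_mul_assoc)
qed

text \<open>With \<open>R = U \<mu> X \<lambda> U\<^sup>t\<close> and \<open>P = U \<lambda>\<^sup>2 U\<^sup>*\<close> one has \<open>T = conj R P\<^sup>-\<^sup>1\<close>; the choice of \<open>X\<close> makes \<open>R\<close>
  symmetric, and \<open>\<mu>\<^sup>2 = \<lambda>\<^sup>2 - \<rho>\<^sup>2\<close> turns \<open>R T\<^sup>t = U \<mu>\<^sup>2 U\<^sup>*\<close> into \<open>P - \<rho>\<^sup>2\<close>.\<close>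

lemma oscillator_Q_mat:
  fixes A B C U X :: "complex^'n^'n"
  assumes A: "transpose A = A" and C: "transpose C = C" and Cpos: "pos_def_mat (imag_mat C)"
    and lam: "\<And>i. 0 < lam i" and U: "unitary_mat U"
    and diag: "adjoint_mat U ** Phi_zzbar B C ** U = diag_mat (\<lambda>i. (lam i)\<^sup>2)"
    and \<rho>: "0 < \<rho>" "\<And>i. \<rho> < lam i" and X: "unitary_mat X"
    and XT: "transpose X ** diag_mat (\<lambda>i. mu lam \<rho> i / lam i) = diag_mat (\<lambda>i. mu lam \<rho> i / lam i) ** X"
  defines "T \<equiv> cnj_mat U ** diag_mat lam ** adjoint_mat X ** diag_mat (\<lambda>i. mu lam \<rho> i / (lam i)\<^sup>2) ** adjoint_mat U"
  shows "oscillator (Phi_zzbar B C) (Phi_zz A B C) (Q_mat A B C U lam \<rho> X) T (\<rho>\<^sup>2) (\<rho>\<^sup>2 / 2)"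
proof -
  let ?m = "mu lam \<rho>"
  define P S R where "P = Phi_zzbar B C" and "S = Phi_zz A B C"
    and "R = U ** diag_mat ?m ** X ** diag_mat lam ** transpose U"
  have m: "(?m i)\<^sup>2 = (lam i)\<^sup>2 - \<rho>\<^sup>2" for i
  proof -
    have "\<rho>\<^sup>2 \<le> (lam i)\<^sup>2" by (intro power_mono less_imp_le \<rho>)
    then show ?thesis by (simp add: mu_def)
  qed
  have lam0: "lam i \<noteq> 0" for i using lam[of i] by simp
  have QS: "Q_mat A B C U lam \<rho> X + S = R" by (simp add: Q_mat_def S_def R_def)
  have U1: "adjoint_mat U ** U = mat 1" "U ** adjoint_mat U = mat 1"
    and X1: "adjoint_mat X ** X = mat 1" "X ** adjoint_mat X = mat 1"
    using U X by (auto simp: unitary_mat_def)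
  have UT: "transpose U ** cnj_mat U = mat 1" and XC: "transpose X ** cnj_mat X = mat 1"
    using arg_cong[OF U1(1), of transpose] arg_cong[OF X1(1), of transpose]
    by (simp_all add: adjoint_mat_def matrix_transpose_mul)
  have cancel: "M ** adjoint_mat U ** U = M" "M ** transpose U ** cnj_mat U = M" "M ** X ** adjoint_mat X = M"
    for M :: "complex^'n^'n"
    using U1 UT X1 by (simp_all flip: matrix_mul_assoc)
  have PU: "P = U ** diag_mat (\<lambda>i. (lam i)\<^sup>2) ** adjoint_mat U"
  proof -
    have "U ** (adjoint_mat U ** P ** U) ** adjoint_mat U = (U ** adjoint_mat U) ** P ** (U ** adjoint_mat U)"
      by (simp only: matrix_mul_assoc)
    then show ?thesis using U1 diag by (simp add: P_def)
  qed
  have adj: "adjoint_mat (M ** N) = adjoint_mat N ** adjoint_mat M" "adjoint_mat (adjoint_mat M) = M"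
    "adjoint_mat (diag_mat d) = diag_mat d" for M N :: "complex^'n^'n" and d
    by (simp_all add: adjoint_mat_def cnj_mat_mult matrix_transpose_mul cnj_mat_transpose cnj_mat_cnj_mat
        cnj_mat_diag transpose_diag)
  have P_herm: "adjoint_mat P = P" by (simp add: PU adj matrix_mul_assoc)
  have S_sym: "transpose S = S" unfolding S_def by (rule Phi_zz_symmetric[OF A C Cpos])
  \<comment> \<open>Multiplying \<open>XT\<close> by \<open>diag_mat lam\<close> on both sides
    clears the quotients and shows that the middle factor of \<open>R\<close> is symmetric.\<close>
  have K: "diag_mat lam ** transpose X ** diag_mat ?m = diag_mat ?m ** X ** diag_mat lam"
  proof -
    have "diag_mat lam ** transpose X ** diag_mat ?m
        = diag_mat lam ** (transpose X ** diag_mat (\<lambda>i. ?m i / lam i)) ** diag_mat lam"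
      using lam0 by (simp add: matrix_mul_assoc diag_mult_assoc)
    also have "\<dots> = diag_mat ?m ** X ** diag_mat lam"
      unfolding XT using lam0 by (simp add: matrix_mul_assoc diag_mult)
    finally show ?thesis .
  qed
  have R_sym: "transpose R = R"
    by (simp add: R_def matrix_transpose_mul transpose_diag matrix_mul_assoc)
      (metis K matrix_mul_assoc)
  have Q_sym: "transpose (Q_mat A B C U lam \<rho> X) = Q_mat A B C U lam \<rho> X"
  proof -
    have "Q_mat A B C U lam \<rho> X = R - S" using QS by (simp add: eq_diff_eq)
    then show ?thesis by (simp add: transpose_minus R_sym S_sym)
  qed
  have T_P: "T ** P = cnj_mat R"
  proof -
    have "T ** P = cnj_mat U ** diag_mat lam ** adjoint_mat X ** diag_mat ?m ** adjoint_mat U"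
      unfolding T_def PU using lam0 by (simp add: matrix_mul_assoc cancel diag_mult_assoc)
    also have "\<dots> = adjoint_mat R"
      unfolding R_def by (simp add: adj matrix_mul_assoc) (simp add: adjoint_mat_def cnj_mat_transpose)
    also have "\<dots> = cnj_mat R"
      by (simp add: adjoint_mat_def R_sym flip: cnj_mat_transpose)
    finally show ?thesis .
  qed
  have T_ccr: "R ** transpose T = P - mat (complex_of_real (\<rho>\<^sup>2))"
  proof -
    \<comment> \<open>The conjugate of \<open>XT\<close> moves \<open>X\<close> past the diagonal
      factor as its adjoint, so that the two copies of \<open>X\<close> in
      \<open>R T\<^sup>t\<close> cancel.\<close>
    have "diag_mat (\<lambda>i. ?m i / lam i) ** cnj_mat X = adjoint_mat X ** diag_mat (\<lambda>i. ?m i / lam i)"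
      using arg_cong[OF XT, of cnj_mat] by (simp add: cnj_mat_mult cnj_mat_diag cnj_mat_transpose adjoint_mat_def)
    then have XX: "M ** diag_mat (\<lambda>i. ?m i / lam i) ** cnj_mat X = M ** adjoint_mat X ** diag_mat (\<lambda>i. ?m i / lam i)"
      for M :: "complex^'n^'n"
      by (simp flip: matrix_mul_assoc)
    have "transpose T = cnj_mat U ** diag_mat (\<lambda>i. ?m i / (lam i)\<^sup>2) ** cnj_mat X ** diag_mat lam ** adjoint_mat U"
      by (simp add: T_def matrix_transpose_mul adjoint_mat_def transpose_diag matrix_mul_assoc)
    then have "R ** transpose T =
        U ** diag_mat ?m ** X ** diag_mat (\<lambda>i. ?m i / lam i) ** cnj_mat X ** diag_mat lam ** adjoint_mat U"
      unfolding R_def using lam0 by (simp add: matrix_mul_assoc cancel diag_mult_assoc power2_eq_square)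
    also have "\<dots> = U ** diag_mat (\<lambda>i. (?m i)\<^sup>2) ** adjoint_mat U"
      using lam0 by (simp add: XX cancel diag_mult_assoc power2_eq_square)
    also have "diag_mat (\<lambda>i. (?m i)\<^sup>2) = diag_mat (\<lambda>i. (lam i)\<^sup>2) - mat (complex_of_real (\<rho>\<^sup>2))"
      by (simp add: vec_eq_iff diag_mat_def mat_def m)
    also have "U ** (diag_mat (\<lambda>i. (lam i)\<^sup>2) - mat (complex_of_real (\<rho>\<^sup>2))) ** adjoint_mat U =
        P - U ** mat (complex_of_real (\<rho>\<^sup>2)) ** adjoint_mat U"
      by (simp add: PU vec_eq_iff matrix_matrix_mult_def left_diff_distrib right_diff_distrib sum_subtractf)
    also have "U ** mat (complex_of_real (\<rho>\<^sup>2)) = mat (complex_of_real (\<rho>\<^sup>2)) ** U"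
      by (simp add: vec_eq_iff matrix_matrix_mult_def mat_def if_distrib if_distribR mult.commute cong: if_cong)
    also have "mat (complex_of_real (\<rho>\<^sup>2)) ** U ** adjoint_mat U = mat (complex_of_real (\<rho>\<^sup>2))"
      by (simp add: U1 flip: matrix_mul_assoc)
    finally show ?thesis .
  qed
  \<comment> \<open>The \<open>P\<close> term equals \<open>(norm v)\<^sup>2\<close>. By the
    arithmetic-geometric mean inequality the \<open>R\<close> term is at most half of
    \<open>(norm v)\<^sup>2\<close> plus half of the sum of
    \<open>\<mu>\<^sup>2 |w|\<^sup>2\<close>; as
    \<open>\<mu>\<^sup>2 = \<lambda>\<^sup>2 - \<rho>\<^sup>2\<close>, exactly
    \<open>\<rho>\<^sup>2 / 2\<close> is left over.\<close>
  have coercive: "\<rho>\<^sup>2 / 2 * (norm z)\<^sup>2 \<le> Re (bilin z (P *v cnj_vec z)) + Re (bilin z (R *v z))" for z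
  proof -
    define w where "w = transpose U *v z"
    define v where "v = diag_mat lam *v w"
    have w: "norm w = norm z"
      unfolding w_def by (rule norm_isometry) (use U1 in \<open>simp add: cnj_mat_transpose flip: adjoint_mat_def\<close>)
    have Xv: "norm (X *v v) = norm v" by (rule norm_isometry[OF XC])
    have v: "(norm v)\<^sup>2 = (\<Sum>i\<in>UNIV. (lam i)\<^sup>2 * (cmod (w $ i))\<^sup>2)"
      by (simp add: norm_sum_squares v_def diag_mv norm_mult power_mult_distrib)
    have "bilin z (P *v cnj_vec z) = bilin w (diag_mat (\<lambda>i. (lam i)\<^sup>2) *v cnj_vec w)"
      unfolding PU w_def cnj_vec_mv
      by (simp only: matrix_vector_mul_assoc bilin_mv_left cnj_mat_transpose adjoint_mat_def flip: matrix_mul_assoc)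
    also have "\<dots> = complex_of_real (\<Sum>i\<in>UNIV. (lam i)\<^sup>2 * (cmod (w $ i))\<^sup>2)"
      by (simp add: bilin_def diag_mv cnj_vec_def complex_norm_square mult_ac del: of_real_power)
    finally have 1: "Re (bilin z (P *v cnj_vec z)) = (norm v)\<^sup>2" by (simp add: v)
    have "bilin z (R *v z) = bilin w (diag_mat ?m *v (X *v v))"
      unfolding R_def w_def v_def
      by (simp only: matrix_vector_mul_assoc bilin_mv_left flip: matrix_mul_assoc)
    then have "cmod (bilin z (R *v z)) \<le> (\<Sum>i\<in>UNIV. cmod (w $ i * (complex_of_real (?m i) * (X *v v) $ i)))"
      unfolding bilin_def diag_mv by (simp only: norm_sum)
    also have "\<dots> \<le> (\<Sum>i\<in>UNIV. ((?m i)\<^sup>2 * (cmod (w $ i))\<^sup>2 + (cmod ((X *v v) $ i))\<^sup>2) / 2)"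
    proof (rule sum_mono)
      fix i
      have "\<rho>\<^sup>2 \<le> (lam i)\<^sup>2" by (intro power_mono less_imp_le \<rho>)
      then have "0 \<le> ?m i" by (simp add: mu_def)
      then show "cmod (w $ i * (complex_of_real (?m i) * (X *v v) $ i)) \<le>
          ((?m i)\<^sup>2 * (cmod (w $ i))\<^sup>2 + (cmod ((X *v v) $ i))\<^sup>2) / 2"
        using sum_squares_bound[of "?m i * cmod (w $ i)" "cmod ((X *v v) $ i)"]
        by (simp add: norm_mult power_mult_distrib mult_ac)
    qed
    also have "\<dots> = ((\<Sum>i\<in>UNIV. (?m i)\<^sup>2 * (cmod (w $ i))\<^sup>2) + (norm (X *v v))\<^sup>2) / 2"
      by (simp add: norm_sum_squares sum.distrib flip: sum_divide_distrib)
    also have "(\<Sum>i\<in>UNIV. (?m i)\<^sup>2 * (cmod (w $ i))\<^sup>2) = (norm v)\<^sup>2 - \<rho>\<^sup>2 * (norm w)\<^sup>2"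
      unfolding v by (simp add: m norm_sum_squares left_diff_distrib sum_subtractf sum_distrib_left)
    finally have "cmod (bilin z (R *v z)) \<le> (norm v)\<^sup>2 - \<rho>\<^sup>2 / 2 * (norm z)\<^sup>2"
      by (simp add: Xv w)
    moreover have "- cmod (bilin z (R *v z)) \<le> Re (bilin z (R *v z))"
      using abs_Re_le_cmod[of "bilin z (R *v z)"] by linarith
    ultimately show ?thesis using 1 by linarith
  qed
  show ?thesis
    unfolding P_def [symmetric] S_def [symmetric]
    by unfold_locales (use P_herm S_sym Q_sym T_P T_ccr \<rho> coercive QS in auto)
qed

theorem theorem8:
  fixes A B C U X Q :: "complex^'n::{finite,linorder}^'n::{finite,linorder}"
    and lam :: "'n::{finite,linorder} \<Rightarrow> real" and \<rho> :: real and \<Phi> :: "complex^'n::{finite,linorder} \<Rightarrow> real"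
    and \<alpha> \<beta> :: "nat^'n::{finite,linorder}"
  assumes "transpose A = A" and "det B \<noteq> 0" and "transpose C = C" and "pos_def_mat (imag_mat C)"
    and \<Phi>: "\<Phi> = Phi A B C"
    and "\<And>i. 0 < lam i"
    and "unitary_mat U"
    and "adjoint_mat U ** Phi_zzbar B C ** U = diag_mat (\<lambda>i. (lam i)\<^sup>2)"
    and "0 < \<rho>" and "\<rho> < Min (range lam)"
    and "unitary_mat X"
    and "transpose X ** diag_mat (\<lambda>i. mu lam \<rho> i / lam i) = diag_mat (\<lambda>i. mu lam \<rho> i / lam i) ** X"
    and Q: "Q = Q_mat A B C U lam \<rho> X"
  shows "psi \<Phi> Q \<alpha> \<in> H_space \<Phi> \<and>
         H_op \<Phi> Q \<rho> (psi \<Phi> Q \<alpha>) =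
           (\<lambda>z. (2 * of_nat (multi_abs \<alpha>) + 1) * complex_of_real (\<rho>\<^sup>2) * psi \<Phi> Q \<alpha> z) \<and>
         H_inner \<Phi> (psi \<Phi> Q \<alpha>) (psi \<Phi> Q \<beta>) =
           (if \<alpha> = \<beta>
            then complex_of_real ((2 * \<rho>\<^sup>2) ^ multi_abs \<alpha> * real (multi_fact \<alpha>) * (H_norm \<Phi> (psi0 Q))\<^sup>2)
            else 0)"
proof -
  have "\<rho> < lam i" for i
    using \<open>\<rho> < Min (range lam)\<close> by (simp add: Min_gr_iff)
  from oscillator_Q_mat[OF assms(1,3,4,6-9) this assms(11,12)]
  obtain T where "oscillator (Phi_zzbar B C) (Phi_zz A B C) Q T (\<rho>\<^sup>2) (\<rho>\<^sup>2 / 2)"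
    unfolding Q by blast
  then interpret oscillator "Phi_zzbar B C" "Phi_zz A B C" Q T "\<rho>\<^sup>2" "\<rho>\<^sup>2 / 2" .
  have wt: "wt = \<Phi>" by (simp add: fun_eq_iff wt_def \<Phi> Phi_def)
  let ?xs = "sorted_list_of_set (UNIV :: 'n set)"
  have xs: "distinct ?xs" "set ?xs = UNIV" by auto
  have psi: "psi \<Phi> Q a = state ?xs (\<lambda>i. a $ i)" for a
    unfolding wt [symmetric] by (simp add: psi_def state_def)
  have "psi \<Phi> Q \<alpha> \<in> H_space \<Phi>"
    using gp_H_space[OF state_V] by (simp add: psi wt)
  moreover have "H_op \<Phi> Q \<rho> (psi \<Phi> Q \<alpha>) z =
      (2 * of_nat (multi_abs \<alpha>) + 1) * complex_of_real (\<rho>\<^sup>2) * psi \<Phi> Q \<alpha> z" for z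
  proof -
    \<comment> \<open>Summing over \<open>i\<close> gives \<open>2 \<rho>\<^sup>2\<close> times the
      degree; the constant term of \<open>H_op\<close> supplies the final summand 1.\<close>
    have "Lambda_star \<Phi> Q i (Lambda Q i (psi \<Phi> Q \<alpha>)) = (\<lambda>z. 2 * complex_of_real (\<rho>\<^sup>2) * of_nat (\<alpha> $ i) * psi \<Phi> Q \<alpha> z)" for i
      using number_state[OF xs(1), of i "\<lambda>i. \<alpha> $ i"] xs(2) by (simp add: psi wt)
    then show ?thesis
      by (simp add: H_op_def multi_abs_def algebra_simps flip: sum_distrib_left sum_distrib_right)
  qed
  moreover have "H_inner \<Phi> (psi \<Phi> Q \<alpha>) (psi \<Phi> Q \<beta>) =
           (if \<alpha> = \<beta>
            then complex_of_real ((2 * \<rho>\<^sup>2) ^ multi_abs \<alpha> * real (multi_fact \<alpha>) * (H_norm \<Phi> (psi0 Q))\<^sup>2)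
            else 0)"
    using ip_state[OF xs(1), of "\<lambda>i. \<alpha> $ i" "\<lambda>i. \<beta> $ i"] xs(2) H_inner_self[of \<Phi> "psi0 Q"]
    by (simp add: psi wt multi_abs_def multi_fact_def vec_eq_iff)
  ultimately show ?thesis by blast
qed

end
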